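(* Suppose $\Delta = \Omega(\log^{4+\epsilon} n)$ for some constant $\epsilon>0$. There is an algorithm that solves the $(\Delta+1)$-list coloring problem on $n$-vertex graphs of maximum degree $\Delta$ in the $\mathsf{CONGESTED}\text{-}\mathsf{CLIQUE}$ model in $O(1)$ rounds.
   Context: The $(\Delta+1)$-list coloring problem: given $G=(V,E)$ with maximum degree $\Delta$ and a list $\Psi(v)$ of $\Delta+1$ colors for each vertex, find a proper coloring with each $v$ colored from $\Psi(v)$. $\mathsf{CONGESTED}\text{-}\mathsf{CLIQUE}$ model: $n=|V|$ processors, one per vertex, each knowing its incident edges and list; in each synchronous round each vertex may send a distinct $O(\log n)$-bit message to every other vertex. Convention: randomized algorithms are required to succeed with probability at least $1-1/\mathrm{poly}(n)$.
   Formalization: Colors are assumed to be representable with O(log n) bits; with colors from an unbounded universe the claim fails on complete graphs, by a Ramsey argument. *)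

theory Defs
  imports "HOL-Probability.Probability" "HOL-Library.Landau_Symbols"
begin

subsection \<open>Graphs and list colorings\<close>

definition simple_graph :: "'v set \<Rightarrow> ('v \<times> 'v) set \<Rightarrow> bool" where
  "simple_graph V E \<longleftrightarrow> finite V \<and> E \<subseteq> V \<times> V \<and> sym E \<and> irrefl E"

definition neighbors :: "('v \<times> 'v) set \<Rightarrow> 'v \<Rightarrow> 'v set" where
  "neighbors E v = E `` {v}"

definition max_degree :: "'v set \<Rightarrow> ('v \<times> 'v) set \<Rightarrow> nat" where
  "max_degree V E = Max ((\<lambda>v. card (neighbors E v)) ` V)"

definition list_coloring_instance ::
  "'v set \<Rightarrow> ('v \<times> 'v) set \<Rightarrow> ('v \<Rightarrow> 'c set) \<Rightarrow> bool" where
  "list_coloring_instance V E \<Psi> \<longleftrightarrow>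
     simple_graph V E \<and> (\<forall>v\<in>V. card (\<Psi> v) = max_degree V E + 1)"

definition proper_list_coloring ::
  "'v set \<Rightarrow> ('v \<times> 'v) set \<Rightarrow> ('v \<Rightarrow> 'c set) \<Rightarrow> ('v \<Rightarrow> 'c) \<Rightarrow> bool" where
  "proper_list_coloring V E \<Psi> f \<longleftrightarrow>
     (\<forall>v\<in>V. f v \<in> \<Psi> v) \<and> (\<forall>(u, v)\<in>E. f u \<noteq> f v)"


subsection \<open>The congested clique\<close>

text \<open>
  The processors of an \<open>n\<close>-vertex clique are \<open>0, \<dots>, n - 1\<close>. As local memory and local computation
  are unrestricted, the state of a processor is taken to be everything it has seen: its
  identifier, its input, its private coin flips, and, for each past round in chronological order,
  the message received from every processor. All coins are flipped in advance; a processor may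
  ignore some of them until later rounds.
\<close>

type_synonym message = "bool list"

record 'i view =
  ident :: nat
  input :: 'i
  coins :: "bool list"
  inbox :: "(nat \<Rightarrow> message) list"

text \<open>
  The first argument of every component is the number \<open>n\<close> of processors. \<open>send A n s w\<close> is the
  message that a processor in state \<open>s\<close> addresses to processor \<open>w\<close>.
\<close>

record ('i, 'o) cc_algorithm =
  num_coins :: "nat \<Rightarrow> nat"
  rounds :: "nat \<Rightarrow> nat"
  send :: "nat \<Rightarrow> 'i view \<Rightarrow> nat \<Rightarrow> message"
  result :: "nat \<Rightarrow> 'i view \<Rightarrow> 'o"

definition congested_clique_bandwidth :: "('i, 'o) cc_algorithm \<Rightarrow> bool" where
  "congested_clique_bandwidth A \<longleftrightarrow>
     (\<exists>b :: nat \<Rightarrow> nat. (\<lambda>n. real (b n)) \<in> O(\<lambda>n. ln (real n)) \<and>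
        (\<forall>n s w. length (send A n s w) \<le> b n))"

text \<open>\<open>view_after A n x \<omega> t v\<close>: the state of \<open>v\<close> after \<open>t\<close> rounds on inputs \<open>x\<close> and coins \<open>\<omega>\<close>.\<close>

primrec view_after ::
  "('i, 'o) cc_algorithm \<Rightarrow> nat \<Rightarrow> (nat \<Rightarrow> 'i) \<Rightarrow> (nat \<Rightarrow> bool list) \<Rightarrow> nat \<Rightarrow> nat \<Rightarrow> 'i view" where
  "view_after A n x \<omega> 0 =
     (\<lambda>v. \<lparr>ident = v, input = x v, coins = \<omega> v, inbox = []\<rparr>)"
| "view_after A n x \<omega> (Suc t) =
     (\<lambda>v. \<lparr>ident = v, input = x v, coins = \<omega> v,
           inbox = inbox (view_after A n x \<omega> t v) @
             [\<lambda>u. if u < n \<and> u \<noteq> v then send A n (view_after A n x \<omega> t u) v else []]\<rparr>)"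

definition coin_flips :: "nat \<Rightarrow> nat \<Rightarrow> (nat \<Rightarrow> bool list) pmf" where
  "coin_flips n r = Pi_pmf {..<n} [] (\<lambda>_. pmf_of_set {bs :: bool list. length bs = r})"

definition run :: "('i, 'o) cc_algorithm \<Rightarrow> nat \<Rightarrow> (nat \<Rightarrow> 'i) \<Rightarrow> (nat \<Rightarrow> 'o) pmf" where
  "run A n x =
     map_pmf (\<lambda>\<omega> v. result A n (view_after A n x \<omega> (rounds A n) v)) (coin_flips n (num_coins A n))"

text \<open>
  Colors are natural numbers. In the congested clique they have to be restricted to \<open>K n = O(log n)\<close>
  bits, i.e. to \<open>{..<2 ^ K n}\<close>: over an infinite set of colors, a Ramsey argument shows that every
  algorithm with bounded messages fails on the complete graph on \<open>n \<ge> 2\<close> vertices, for some choice of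
  the lists, with probability at least \<open>1 / n\<^sup>2\<close>.
\<close>

definition local_input ::
  "(nat \<times> nat) set \<Rightarrow> (nat \<Rightarrow> nat set) \<Rightarrow> nat \<Rightarrow> nat set \<times> nat set" where
  "local_input E \<Psi> v = (neighbors E v, \<Psi> v)"

end

theory Submission
  imports Defs "HOL-Real_Asymp.Real_Asymp"
begin

text \<open>
  Hash the vertices into bins, a bin being a group of one of five phases, and in each of the first four
  phases hash the colors to its groups. Within a phase, every group collects at a leader the graph it
  induces and, for each vertex, the unused colors that belong to the group; the leader colors the group
  greedily. Groups of a phase use disjoint sets of colors, so they cannot conflict. A vertex survives a
  phase with probability \<open>q\<close>, and this leaves each group with a surplus of colors exceeding the
  random fluctuations, since the colors are split among fewer vertices than the graph still has. The
  groups have size \<open>O(n)\<close>, and so has the graph that survives four phases, because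
  \<open>\<Delta>\<close> dominates \<open>ln n ^ 4\<close>; it forms a single group, which may use all
  colors.

  Hash functions are taken from a fixed polynomial-size family that, by Newman's argument, works for
  all inputs. So \<open>O(log n)\<close> random bits, broadcast by one processor, determine a hash function. The
  colors that are free in phase \<open>j\<close> depend only on the seeds of earlier phases.
\<close>

section \<open>Protocols as knowledge\<close>

text \<open>The exponent 4 comes from two demands on \<open>q\<close>. With
  \<open>x = sqrt \<Delta>\<close>, a group has about \<open>x\<close> colors per vertex, of which a
  fraction \<open>q\<close> is surplus, while counts fluctuate by about \<open>sqrt (y * x)\<close>,
  where \<open>exp (- y)\<close> must be polynomially small; hence \<open>q\<close> has to be of
  order \<open>sqrt (y / x)\<close>. The final group has about \<open>q ^ 4 * n\<close> vertices of
  degree about \<open>q ^ 4 * \<Delta>\<close>. It has size O(n) if \<open>q ^ 8 * \<Delta>\<close>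
  is bounded, that is, if \<open>y ^ 4 = O(\<Delta>)\<close>. As \<open>y = O(ln n)\<close>, the
  \<epsilon> only has to absorb constants.

  One seed fixes the vertex bins of all phases, since they are tested against the graph alone.
  Colors need a fresh hash in every phase, because the set to be hashed is what the earlier phases
  have left over.

  Hash families are obtained by mere existence, separately for each \<open>n\<close>; the model
  permits this, an algorithm being an arbitrary function of \<open>n\<close>. The proof keeps three
  things apart: a reference coloring \<open>phase_col\<close> without any communication, a protocol
  that computes it, and the probability that the seeds make it proper and cheap.\<close>

primrec hist :: "nat \<Rightarrow> (nat \<Rightarrow> 'a \<Rightarrow> (nat \<Rightarrow> message) list \<Rightarrow> nat \<Rightarrow> message) \<Rightarrow> (nat \<Rightarrow> 'a) \<Rightarrow>
    nat \<Rightarrow> nat \<Rightarrow> (nat \<Rightarrow> message) list" where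
  "hist n f x 0 = (\<lambda>v. [])"
| "hist n f x (Suc t) = (\<lambda>v. hist n f x t v @
     [\<lambda>u. if u < n \<and> u \<noteq> v then f u (x u) (hist n f x t u) v else []])"

lemma length_hist [simp]: "length (hist n f x t v) = t"
  by (induction t arbitrary: v) auto

text \<open>
  A world \<open>w\<close> fixes all inputs and coins; \<open>I w v\<close> is a piece of information that
  processor \<open>v\<close> has after \<open>r\<close> rounds in every world of \<open>W\<close>.
\<close>

definition learns :: "nat \<Rightarrow> nat \<Rightarrow> 'w set \<Rightarrow> ('w \<Rightarrow> nat \<Rightarrow> 'a) \<Rightarrow> nat \<Rightarrow> ('w \<Rightarrow> nat \<Rightarrow> 'b) \<Rightarrow> bool" where
  "learns n b W inp r I \<longleftrightarrow>
     (\<exists>f g. (\<forall>u a h w. length (f u a h w) \<le> b) \<and>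
       (\<forall>w\<in>W. \<forall>v<n. I w v = g v (inp w v) (hist n f (inp w) r v)))"

lemma learns_input: "learns n b W inp 0 inp"
  unfolding learns_def
  by (rule exI[of _ "\<lambda>u a h w. []"], rule exI[of _ "\<lambda>v a h. a"]) simp

lemma learns_local:
  assumes "learns n b W inp r I"
    and "\<And>w v. w \<in> W \<Longrightarrow> v < n \<Longrightarrow> J w v = \<phi> v (I w v)"
  shows "learns n b W inp r J"
proof -
  obtain f g where fg: "\<forall>u a h w. length (f u a h w) \<le> b"
    "\<forall>w\<in>W. \<forall>v<n. I w v = g v (inp w v) (hist n f (inp w) r v)"
    using assms(1) unfolding learns_def by blast
  show ?thesis
    unfolding learns_def
    by (rule exI[of _ f], rule exI[of _ "\<lambda>v a h. \<phi> v (g v a h)"]) (use fg assms(2) in auto)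
qed

text \<open>
  Unlike in the model, a processor here receives its message to itself too, as it can compute it.
\<close>

lemma learns_round:
  fixes M :: "'w \<Rightarrow> nat \<Rightarrow> nat \<Rightarrow> message"
  assumes "learns n b W inp r I"
    and M: "\<And>w u v. w \<in> W \<Longrightarrow> u < n \<Longrightarrow> v < n \<Longrightarrow> M w u v = \<mu> u (I w u) v \<and> length (M w u v) \<le> b"
  shows "learns n b W inp (Suc r) (\<lambda>w v. (I w v, \<lambda>u. if u < n then M w u v else []))"
proof -
  obtain f g where f: "\<forall>u a h w. length (f u a h w) \<le> b"
    and g: "\<forall>w\<in>W. \<forall>v<n. I w v = g v (inp w v) (hist n f (inp w) r v)"
    using assms(1) unfolding learns_def by blast
  \<comment> \<open>The length of the history tells which round it is. Truncation by
    \<open>take b\<close> is the identity in the worlds of \<open>W\<close>; elsewhere it enforces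
    the bandwidth, which must hold in every state.\<close>
  define f' where "f' u a h w = (if length h < r then f u a h w else take b (\<mu> u (g u a h) w))"
    for u a h w
  define g' where "g' v a h = (g v a (take r h),
      \<lambda>u. if u < n then if u = v then take b (\<mu> v (g v a (take r h)) v) else (h ! r) u else [])"
    for v a h
  have eq: "hist n f' x t v = hist n f x t v" if "t \<le> r" for x t v
    using that by (induction t arbitrary: v) (auto simp: f'_def)
  have "(I w v, \<lambda>u. if u < n then M w u v else []) = g' v (inp w v) (hist n f' (inp w) (Suc r) v)"
    if w: "w \<in> W" and v: "v < n" for w v
  proof -
    have msg: "M w u v = take b (\<mu> u (g u (inp w u) (hist n f (inp w) r u)) v)" if "u < n" for u
      using M[OF w that v] g w that by auto
    show ?thesis
      using g w v by (auto simp: g'_def eq f'_def nth_append msg fun_eq_iff)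
  qed
  moreover have "length (f' u a h w) \<le> b" for u a h w
    using f by (auto simp: f'_def)
  ultimately show ?thesis
    unfolding learns_def by blast
qed

text \<open>The history together with identifier, input and coins is exactly a \<open>view\<close>.
  Nothing is promised outside \<open>W n\<close> except the bandwidth, so a protocol may be designed
  for favorable worlds only.\<close>

lemma learns_imp_algorithm:
  fixes inp :: "nat \<Rightarrow> 'w \<Rightarrow> nat \<Rightarrow> 'i \<times> bool list" and I :: "nat \<Rightarrow> 'w \<Rightarrow> nat \<Rightarrow> 'o"
  assumes "\<And>n. learns n (b n) (W n) (inp n) (r n) (I n)"
  obtains A :: "('i, 'o) cc_algorithm" where
    "num_coins A = m" "rounds A = r" "\<And>n s w. length (send A n s w) \<le> b n"
    "\<And>n w x \<omega> v. w \<in> W n \<Longrightarrow> inp n w = (\<lambda>v. (x v, \<omega> v)) \<Longrightarrow> v < n \<Longrightarrow>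
       result A n (view_after A n x \<omega> (r n) v) = I n w v"
proof -
  have "\<forall>n. \<exists>f g. (\<forall>u a h w. length (f u a h w) \<le> b n) \<and>
     (\<forall>w\<in>W n. \<forall>v<n. I n w v = g v (inp n w v) (hist n f (inp n w) (r n) v))"
    using assms unfolding learns_def by blast
  then obtain f g where f: "\<And>n u a h w. length (f n u a h w) \<le> b n"
    and g: "\<And>n w v. w \<in> W n \<Longrightarrow> v < n \<Longrightarrow> I n w v = g n v (inp n w v) (hist n (f n) (inp n w) (r n) v)"
    by metis
  define A where "A = \<lparr>num_coins = m, rounds = r,
     send = (\<lambda>n s w. f n (ident s) (input s, coins s) (inbox s) w),
     result = (\<lambda>n s. g n (ident s) (input s, coins s) (inbox s))\<rparr>"
  have view: "view_after A n x \<omega> t v = \<lparr>ident = v, input = x v, coins = \<omega> v,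
      inbox = hist n (f n) (\<lambda>v. (x v, \<omega> v)) t v\<rparr>" for n x \<omega> t v
    by (induction t arbitrary: v) (auto simp: A_def fun_eq_iff)
  show ?thesis
  proof (rule that[of A])
    show "num_coins A = m" "rounds A = r" by (simp_all add: A_def)
    show "length (send A n s w) \<le> b n" for n s w by (simp add: A_def f)
    show "result A n (view_after A n x \<omega> (r n) v) = I n w v"
      if "w \<in> W n" "inp n w = (\<lambda>v. (x v, \<omega> v))" "v < n" for n w x \<omega> v
      unfolding view using g[OF that(1,3)] that(2) by (simp add: A_def)
  qed
qed

text \<open>
  The \<open>k\<close>-th piece \<open>P w v k\<close> of the \<open>l\<close>-th vertex \<open>v\<close> of the group
  \<open>gl w i\<close> travels to the leader \<open>i\<close> through processor \<open>(l * s w + k) mod n\<close>, so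
  that in each of the \<open>c\<close> batches every edge carries at most one piece.
\<close>

lemma learns_gather:
  fixes gl :: "'w \<Rightarrow> nat \<Rightarrow> nat list" and P :: "'w \<Rightarrow> nat \<Rightarrow> nat \<Rightarrow> message"
  assumes I: "learns n b W inp r I"     and gl_known: "\<And>w v. w \<in> W \<Longrightarrow> v < n \<Longrightarrow> gl w = \<gamma> v (I w v)"
    and s_known: "\<And>w v. w \<in> W \<Longrightarrow> v < n \<Longrightarrow> s w = \<sigma> v (I w v)"
    and gl: "\<And>w i. w \<in> W \<Longrightarrow> i < n \<Longrightarrow> distinct (gl w i) \<and> set (gl w i) \<subseteq> {..<n}"
    and disj: "\<And>w i j v. w \<in> W \<Longrightarrow> i < n \<Longrightarrow> j < n \<Longrightarrow> v \<in> set (gl w i) \<Longrightarrow> v \<in> set (gl w j) \<Longrightarrow> i = j"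
    and P: "\<And>w v k. w \<in> W \<Longrightarrow> v < n \<Longrightarrow> P w v k = \<pi> v (I w v) k \<and> length (P w v k) \<le> b"
  shows "learns n b W inp (r + 2 * c) (\<lambda>w i. (I w i, \<lambda>e u. if e < c \<and> u < n \<and> (e * n + u) div s w < length (gl w i)
            then P w (gl w i ! ((e * n + u) div s w)) ((e * n + u) mod s w) else []))"
    (is "learns n b W inp _ (?R c)")
proof (induction c)
  case 0
  show ?case
    by (rule learns_local[where I = I and \<phi> = "\<lambda>v a. (a, \<lambda>e u. [])"]) (use I in auto)
next
  case (Suc c)
  \<comment> \<open>Batch \<open>c\<close> moves position \<open>c * n + u\<close> of every group's
    stream of pieces through relay \<open>u\<close>: \<open>div\<close> by \<open>s w\<close> finds
    the owner of the piece within the group and \<open>mod\<close> its index. \<open>M\<close> is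
    the way from owner to relay, \<open>M'\<close> the way from relay to leader.\<close>
  define M where "M w v u = (if \<exists>i<n. (c * n + u) div s w < length (gl w i) \<and> gl w i ! ((c * n + u) div s w) = v
      then P w v ((c * n + u) mod s w) else [])" for w v u
  have 1: "learns n b W inp (Suc (r + 2 * c)) (\<lambda>w v. (?R c w v, \<lambda>u. if u < n then M w u v else []))"
    by (rule learns_round[OF Suc.IH, where \<mu> = "\<lambda>v a u.
        (if \<exists>i<n. (c * n + u) div \<sigma> v (fst a) < length (\<gamma> v (fst a) i) \<and> \<gamma> v (fst a) i ! ((c * n + u) div \<sigma> v (fst a)) = v
         then \<pi> v (fst a) ((c * n + u) mod \<sigma> v (fst a)) else [])"])
      (auto simp: M_def gl_known[symmetric] s_known[symmetric] P[THEN conjunct1, symmetric] P[THEN conjunct2])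
  define M' where "M' w u i = (if (c * n + u) div s w < length (gl w i)
      then M w (gl w i ! ((c * n + u) div s w)) u else [])" for w u i
  have M'_eq: "M' w u i = (if (c * n + u) div s w < length (gl w i)
      then P w (gl w i ! ((c * n + u) div s w)) ((c * n + u) mod s w) else [])" if "i < n" for w u i
    using that by (auto simp: M'_def M_def)
  have in_gl: "gl w i ! k < n" if "w \<in> W" "i < n" "k < length (gl w i)" for w i k
    using gl[OF that(1,2)] nth_mem[OF that(3)] by auto
  have 2: "learns n b W inp (Suc (Suc (r + 2 * c))) (\<lambda>w v. ((?R c w v, \<lambda>u. if u < n then M w u v else []),
      \<lambda>u. if u < n then M' w u v else []))"
  proof (rule learns_round[OF 1, where \<mu> = "\<lambda>u a i.
        (if (c * n + u) div \<sigma> u (fst (fst a)) < length (\<gamma> u (fst (fst a)) i)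
         then snd a (\<gamma> u (fst (fst a)) i ! ((c * n + u) div \<sigma> u (fst (fst a)))) else [])"], goal_cases)
    case (1 w u v)
    then have "length (M' w u v) \<le> b"
      using in_gl[of w v] by (simp add: M'_eq P[THEN conjunct2])
    with 1 in_gl[of w v] show ?case
      by (simp add: gl_known[symmetric] s_known[symmetric] M'_def)
  qed
  show ?case
  proof (rule learns_local[where \<phi> = "\<lambda>v a. (fst (fst (fst a)),
      \<lambda>e u. if e = c then snd a u else snd (fst (fst a)) e u)"])
    show "learns n b W inp (r + 2 * Suc c) (\<lambda>w v. ((?R c w v, \<lambda>u. if u < n then M w u v else []),
      \<lambda>u. if u < n then M' w u v else []))" using 2 by simp
  qed (auto simp: fun_eq_iff M'_eq less_Suc_eq)
qed

section \<open>Coloring by bins\<close>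

definition bits :: "nat \<Rightarrow> nat \<Rightarrow> bool list" where
  "bits W x = map (bit x) [0..<W]"

definition bits_inv :: "bool list \<Rightarrow> nat" where
  "bits_inv xs = horner_sum of_bool 2 xs"

lemma length_bits [simp]: "length (bits W x) = W"
  by (simp add: bits_def)

lemma bits_inv_bits: "x < 2 ^ W \<Longrightarrow> bits_inv (bits W x) = x"
  unfolding bits_def bits_inv_def horner_sum_bit_eq_take_bit by (simp add: take_bit_nat_eq_self)

definition shorten :: "nat \<Rightarrow> nat set \<Rightarrow> nat set" where
  "shorten k A = set (take k (sorted_list_of_set A))"

lemma shorten_subset: "finite A \<Longrightarrow> shorten k A \<subseteq> A"
  unfolding shorten_def using set_take_subset[of k "sorted_list_of_set A"] by simp

lemma finite_shorten [simp]: "finite (shorten k A)"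
  by (simp add: shorten_def)

lemma card_shorten: "card (shorten k A) = min k (card A)"
  unfolding shorten_def by (simp add: distinct_card min.commute)

text \<open>\<open>SOME\<close> makes the choice a function of the data on \<open>B\<close>. A
  leader that reconstructs these data therefore finds the same coloring as the reference run, by
  \<open>local_coloring_cong\<close>.\<close>

definition local_coloring :: "nat set \<Rightarrow> (nat \<Rightarrow> nat set) \<Rightarrow> (nat \<Rightarrow> nat set) \<Rightarrow> nat \<Rightarrow> nat" where
  "local_coloring B N P = (SOME f. \<forall>v\<in>B. f v \<in> P v \<and> (\<forall>u\<in>N v. f u \<noteq> f v))"

lemma local_coloring_cong:
  assumes "B = B'" "\<And>v. v \<in> B' \<Longrightarrow> N v = N' v" "\<And>v. v \<in> B' \<Longrightarrow> P v = P' v"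
  shows "local_coloring B N P = local_coloring B' N' P'"
  unfolding local_coloring_def using assms by (auto cong: ball_cong)

text \<open>Any order works: when a vertex is reached, its neighbors block fewer colors than its
  palette contains.\<close>

lemma greedy_list_coloring:
  assumes "finite B" "\<And>v. v \<in> B \<Longrightarrow> N v \<subseteq> B - {v}" "\<And>u v. u \<in> N v \<Longrightarrow> v \<in> B \<Longrightarrow> v \<in> N u"
    "\<And>v. v \<in> B \<Longrightarrow> card (N v) < card (P v)"
  shows "\<exists>f. \<forall>v\<in>B. f v \<in> P v \<and> (\<forall>u\<in>N v. f u \<noteq> f v)"
proof -
  have "\<exists>f. \<forall>v\<in>A. f v \<in> P v \<and> (\<forall>u\<in>N v \<inter> A. f u \<noteq> f v)" if "A \<subseteq> B" for A
    using finite_subset[OF that assms(1)] that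
  proof (induction A rule: finite_induct)
    case (insert x A)
    then obtain f where f: "\<forall>v\<in>A. f v \<in> P v \<and> (\<forall>u\<in>N v \<inter> A. f u \<noteq> f v)" by auto
    have fin: "finite (N x)"
      using insert.prems assms(1) assms(2)[of x] by (auto intro: finite_subset)
    have "\<not> P x \<subseteq> f ` N x"
    proof
      assume "P x \<subseteq> f ` N x"
      then have "card (P x) \<le> card (N x)"
        using fin by (meson card_image_le card_mono finite_imageI le_trans)
      then show False using assms(4)[of x] insert.prems by auto
    qed
    then obtain c where c: "c \<in> P x" "c \<notin> f ` N x" by blast
    have "(f(x := c)) v \<in> P v \<and> (\<forall>u\<in>N v \<inter> insert x A. (f(x := c)) u \<noteq> (f(x := c)) v)"
      if v: "v \<in> insert x A" for v
    proof (cases "v = x")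
      case True
      then show ?thesis using c assms(2)[of x] insert.prems by auto
    next
      case False
      then have "v \<in> A" using v by auto
      moreover have "f v \<noteq> c" if "x \<in> N v"
        using assms(3)[OF that] \<open>v \<in> A\<close> insert.prems c by blast
      ultimately show ?thesis using f False by auto
    qed
    then show ?case by blast
  qed auto
  from this[of B] obtain f where "\<forall>v\<in>B. f v \<in> P v \<and> (\<forall>u\<in>N v \<inter> B. f u \<noteq> f v)" by auto
  moreover have "N v \<inter> B = N v" if "v \<in> B" for v using assms(2)[OF that] by auto
  ultimately show ?thesis by metis
qed

text \<open>
  A bin is a pair of a phase and a group. In each phase the groups use disjoint sets of colors:
  \<open>\<gamma> j c\<close> is the group of phase \<open>j\<close> that may use color \<open>c\<close>.
\<close>

definition bin_class :: "nat \<Rightarrow> (nat \<Rightarrow> nat \<times> nat) \<Rightarrow> nat \<times> nat \<Rightarrow> nat set" where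
  "bin_class n \<beta> p = {v. v < n \<and> \<beta> v = p}"

definition bin_nbrs :: "(nat \<Rightarrow> nat \<times> nat) \<Rightarrow> (nat \<Rightarrow> nat set) \<Rightarrow> nat \<Rightarrow> nat set" where
  "bin_nbrs \<beta> N v = {u \<in> N v. \<beta> u = \<beta> v}"

definition free_colors :: "(nat \<Rightarrow> nat \<times> nat) \<Rightarrow> (nat \<Rightarrow> nat set) \<Rightarrow> (nat \<Rightarrow> nat set) \<Rightarrow>
    (nat \<Rightarrow> nat) \<Rightarrow> nat \<Rightarrow> nat \<Rightarrow> nat set" where
  "free_colors \<beta> N \<Psi> f j v = {c \<in> \<Psi> v. \<forall>u\<in>N v. fst (\<beta> u) < j \<longrightarrow> f u \<noteq> c}"

definition bin_palette :: "(nat \<Rightarrow> nat \<times> nat) \<Rightarrow> (nat \<Rightarrow> nat \<Rightarrow> nat) \<Rightarrow> (nat \<Rightarrow> nat set) \<Rightarrow>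
    (nat \<Rightarrow> nat set) \<Rightarrow> (nat \<Rightarrow> nat) \<Rightarrow> nat \<Rightarrow> nat \<Rightarrow> nat set" where
  "bin_palette \<beta> \<gamma> N \<Psi> f j v = {c \<in> free_colors \<beta> N \<Psi> f j v. \<gamma> j c = snd (\<beta> v)}"

lemma bin_paletteD:
  assumes "c \<in> bin_palette \<beta> \<gamma> N \<Psi> f j v"
  shows "c \<in> \<Psi> v" "\<gamma> j c = snd (\<beta> v)" "u \<in> N v \<Longrightarrow> fst (\<beta> u) < j \<Longrightarrow> f u \<noteq> c"
  using assms by (auto simp: bin_palette_def free_colors_def)

text \<open>Greedy coloring needs just one color more than the degree inside the bin. Dropping the
  others leaves a vertex of degree \<open>d\<close> in its bin with at most \<open>2 * d + 1\<close>
  numbers to report.\<close>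

definition short_palette :: "(nat \<Rightarrow> nat \<times> nat) \<Rightarrow> (nat \<Rightarrow> nat \<Rightarrow> nat) \<Rightarrow> (nat \<Rightarrow> nat set) \<Rightarrow>
    (nat \<Rightarrow> nat set) \<Rightarrow> (nat \<Rightarrow> nat) \<Rightarrow> nat \<Rightarrow> nat \<Rightarrow> nat set" where
  "short_palette \<beta> \<gamma> N \<Psi> f j v = shorten (Suc (card (bin_nbrs \<beta> N v))) (bin_palette \<beta> \<gamma> N \<Psi> f j v)"

text \<open>The reference run: a function of graph, lists, bins and hashes, without messages. The
  protocol is proved to compute it, and the probabilistic analysis speaks about it alone.\<close>

primrec phase_col :: "nat \<Rightarrow> (nat \<Rightarrow> nat \<times> nat) \<Rightarrow> (nat \<Rightarrow> nat \<Rightarrow> nat) \<Rightarrow> (nat \<Rightarrow> nat set) \<Rightarrow>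
    (nat \<Rightarrow> nat set) \<Rightarrow> nat \<Rightarrow> nat \<Rightarrow> nat" where
  "phase_col n \<beta> \<gamma> N \<Psi> 0 = (\<lambda>v. 0)"
| "phase_col n \<beta> \<gamma> N \<Psi> (Suc j) = (\<lambda>v. if v < n \<and> fst (\<beta> v) = j
     then local_coloring (bin_class n \<beta> (\<beta> v)) (bin_nbrs \<beta> N)
            (short_palette \<beta> \<gamma> N \<Psi> (phase_col n \<beta> \<gamma> N \<Psi> j) j) v
     else phase_col n \<beta> \<gamma> N \<Psi> j v)"

text \<open>The slack condition compares degree and palette inside one bin, for the colors that the
  run itself has left over; it is a condition on the outcome of the hashing.\<close>

locale binned_coloring =
  fixes n T :: nat and E :: "(nat \<times> nat) set" and \<Psi> :: "nat \<Rightarrow> nat set"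
    and \<beta> :: "nat \<Rightarrow> nat \<times> nat" and \<gamma> :: "nat \<Rightarrow> nat \<Rightarrow> nat"
  assumes graph: "simple_graph {..<n} E"
    and finite_list: "v < n \<Longrightarrow> finite (\<Psi> v)"
    and phase_less: "v < n \<Longrightarrow> fst (\<beta> v) < T"
    and slack: "v < n \<Longrightarrow> card (bin_nbrs \<beta> (neighbors E) v) <
      card (bin_palette \<beta> \<gamma> (neighbors E) \<Psi> (phase_col n \<beta> \<gamma> (neighbors E) \<Psi> (fst (\<beta> v))) (fst (\<beta> v)) v)"
begin

abbreviation "N \<equiv> neighbors E"
abbreviation "col \<equiv> phase_col n \<beta> \<gamma> N \<Psi>"

lemma neighbors_less: "u \<in> N v \<Longrightarrow> u < n \<and> v < n \<and> u \<noteq> v"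
  using graph by (auto simp: simple_graph_def neighbors_def irrefl_def)

lemma neighbors_sym: "u \<in> N v \<Longrightarrow> v \<in> N u"
  using graph by (auto simp: simple_graph_def neighbors_def sym_def)

lemma col_step:
  assumes v: "v < n"
  shows "col (Suc (fst (\<beta> v))) v \<in> bin_palette \<beta> \<gamma> N \<Psi> (col (fst (\<beta> v))) (fst (\<beta> v)) v"
    and "u \<in> N v \<Longrightarrow> \<beta> u = \<beta> v \<Longrightarrow> col (Suc (fst (\<beta> v))) u \<noteq> col (Suc (fst (\<beta> v))) v"
proof -
  define j where "j = fst (\<beta> v)"
  define B where "B = bin_class n \<beta> (\<beta> v)"
  define P where "P = short_palette \<beta> \<gamma> N \<Psi> (col j) j"
  have B: "x \<in> B \<longleftrightarrow> x < n \<and> \<beta> x = \<beta> v" for x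
    by (auto simp: B_def bin_class_def)
  have sub: "P x \<subseteq> bin_palette \<beta> \<gamma> N \<Psi> (col j) j x" if "x \<in> B" for x
    unfolding P_def short_palette_def
    by (rule shorten_subset) (use that finite_list[of x] B in \<open>auto simp: bin_palette_def free_colors_def\<close>)
  have "\<exists>f. \<forall>v\<in>B. f v \<in> P v \<and> (\<forall>u\<in>bin_nbrs \<beta> N v. f u \<noteq> f v)"
  proof (rule greedy_list_coloring)
    show "finite B" by (simp add: B_def bin_class_def)
    show "bin_nbrs \<beta> N x \<subseteq> B - {x}" if "x \<in> B" for x
      using that neighbors_less by (auto simp: bin_nbrs_def B)
    show "x \<in> bin_nbrs \<beta> N y" if "y \<in> bin_nbrs \<beta> N x" for x y
      using that neighbors_sym by (auto simp: bin_nbrs_def)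
    show "card (bin_nbrs \<beta> N x) < card (P x)" if "x \<in> B" for x
      using slack[of x] that by (auto simp: P_def short_palette_def card_shorten B j_def)
  qed
  then have *: "\<forall>x\<in>B. local_coloring B (bin_nbrs \<beta> N) P x \<in> P x \<and>
      (\<forall>u\<in>bin_nbrs \<beta> N x. local_coloring B (bin_nbrs \<beta> N) P u \<noteq> local_coloring B (bin_nbrs \<beta> N) P x)"
    unfolding local_coloring_def by (rule someI_ex)
  have col: "col (Suc j) x = local_coloring B (bin_nbrs \<beta> N) P x" if "x \<in> B" for x
    using that[unfolded B] by (simp add: B_def P_def j_def)
  have "v \<in> B" using v by (simp add: B)
  then have "col (Suc j) v \<in> bin_palette \<beta> \<gamma> N \<Psi> (col j) j v"
    using * sub unfolding col[OF \<open>v \<in> B\<close>] by blast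
  then show "col (Suc (fst (\<beta> v))) v \<in> bin_palette \<beta> \<gamma> N \<Psi> (col (fst (\<beta> v))) (fst (\<beta> v)) v"
    unfolding j_def .
  show "col (Suc (fst (\<beta> v))) u \<noteq> col (Suc (fst (\<beta> v))) v" if u: "u \<in> N v" "\<beta> u = \<beta> v"
  proof -
    have "u \<in> B" "u \<in> bin_nbrs \<beta> N v"
      using u neighbors_less[OF u(1)] by (auto simp: B bin_nbrs_def)
    then show ?thesis
      using * \<open>v \<in> B\<close> unfolding j_def[symmetric] col[OF \<open>v \<in> B\<close>] col[OF \<open>u \<in> B\<close>] by blast
  qed
qed

lemma col_stable: "fst (\<beta> v) < j \<Longrightarrow> col j v = col (Suc (fst (\<beta> v))) v"
  by (induction j) (auto simp: less_Suc_eq)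

text \<open>An edge inside a bin is handled by the greedy coloring, an edge between two groups of a
  phase by the disjoint color sets of \<gamma>, and an edge between phases because the later
  endpoint has discarded the color of the earlier one.\<close>

lemma proper_list_coloring_col: "proper_list_coloring {..<n} E \<Psi> (col T)"
  unfolding proper_list_coloring_def
proof (intro conjI ballI)
  fix v assume v: "v \<in> {..<n}"
  then show "col T v \<in> \<Psi> v"
    using col_step(1)[of v, THEN bin_paletteD(1)] col_stable[of v T] phase_less[of v]
    by (simp del: phase_col.simps)
next
  have *: "col T u \<noteq> col T v" if uv: "u \<in> N v" "fst (\<beta> u) \<le> fst (\<beta> v)" for u v
  proof -
    have less: "u < n" "v < n" using neighbors_less[OF uv(1)] by auto
    have cT: "col T u = col (Suc (fst (\<beta> u))) u" "col T v = col (Suc (fst (\<beta> v))) v"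
      by (rule col_stable[OF phase_less[OF less(1)]] col_stable[OF phase_less[OF less(2)]])+
    show ?thesis
    proof (cases "fst (\<beta> u) = fst (\<beta> v)")
      case True
      show ?thesis
      proof (cases "\<beta> u = \<beta> v")
        case True
        then show ?thesis using col_step(2)[OF less(2) uv(1)] cT by metis
      next
        case False
        then have "snd (\<beta> u) \<noteq> snd (\<beta> v)" using True by (simp add: prod_eq_iff)
        then show ?thesis
          using col_step(1)[OF less(1), THEN bin_paletteD(2)] col_step(1)[OF less(2), THEN bin_paletteD(2)]
          unfolding cT True by metis
      qed
    next
      case False
      then have "fst (\<beta> u) < fst (\<beta> v)" using uv by auto
      then show ?thesis
        using bin_paletteD(3)[OF col_step(1)[OF less(2)] uv(1)] col_stable[of u "fst (\<beta> v)"]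
        unfolding cT by metis
    qed
  qed
  fix e assume "e \<in> E"
  then obtain u v where e: "e = (u, v)" "v \<in> N u" by (cases e) (auto simp: neighbors_def)
  show "case e of (u, v) \<Rightarrow> col T u \<noteq> col T v"
    using *[of u v] *[of v u] e neighbors_sym[OF e(2)] nat_le_linear[of "fst (\<beta> u)" "fst (\<beta> v)"]
    by (auto simp del: phase_col.simps)
qed

lemma col_in_list: "v < n \<Longrightarrow> fst (\<beta> v) < j \<Longrightarrow> col j v \<in> \<Psi> v"
  using col_step(1)[of v, THEN bin_paletteD(1)] col_stable[of v j]
  by (simp del: phase_col.simps)

end

section \<open>Solving one phase\<close>

lemma bits_eq_iff: "x < 2 ^ W \<Longrightarrow> y < 2 ^ W \<Longrightarrow> bits W x = bits W y \<longleftrightarrow> x = y"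
  by (metis bits_inv_bits)

text \<open>The first bit tells neighbors from colors. It also makes every piece nonempty, so that
  \<open>[]\<close> can serve as padding.\<close>

definition pieces :: "nat \<Rightarrow> nat set \<Rightarrow> nat set \<Rightarrow> message list" where
  "pieces m A B = map (\<lambda>u. True # bits m u) (sorted_list_of_set A) @
     map (\<lambda>c. False # bits m c) (sorted_list_of_set B)"

lemma length_pieces: "length (pieces m A B) = card A + card B"
  by (simp add: pieces_def)

lemma set_pieces: "finite A \<Longrightarrow> finite B \<Longrightarrow>
    set (pieces m A B) = (\<lambda>u. True # bits m u) ` A \<union> (\<lambda>c. False # bits m c) ` B"
  by (simp add: pieces_def)

text \<open>What a leader reads in \<open>c\<close> batches from all relays is the complete stream:
  position \<open>r * s + k\<close> is below \<open>c * n\<close>, hence of the form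
  \<open>e * n + u\<close> with \<open>e < c\<close> and \<open>u < n\<close>.\<close>

lemma range_div_mod:
  fixes s n c :: nat
  assumes "distinct xs" "v \<in> set xs" "length xs * s \<le> c * n" "s > 0"
  shows "{F (xs ! ((e * n + u) div s)) ((e * n + u) mod s) |e u. e < c \<and> u < n \<and>
      (e * n + u) div s < length xs \<and> xs ! ((e * n + u) div s) = v} = F v ` {..<s}"
proof (intro equalityI subsetI)
  fix y assume "y \<in> F v ` {..<s}"
  then obtain k where k: "k < s" "y = F v k" by auto
  obtain r where r: "r < length xs" "xs ! r = v" using assms(2) by (auto simp: in_set_conv_nth)
  define t where "t = r * s + k"
  have "t < Suc r * s" using k by (simp add: t_def)
  also have "\<dots> \<le> length xs * s" using r by (intro mult_right_mono) auto
  also note assms(3)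
  finally have "t < c * n" .
  then have "n > 0" "t div n < c"
    by (auto intro: gr0I simp: less_mult_imp_div_less)
  then show "y \<in> {F (xs ! ((e * n + u) div s)) ((e * n + u) mod s) |e u. e < c \<and> u < n \<and>
      (e * n + u) div s < length xs \<and> xs ! ((e * n + u) div s) = v}"
    using k r by (intro CollectI exI[of _ "t div n"] exI[of _ "t mod n"]) (simp add: t_def)
qed (use assms in auto)

lemma image_nth_padded:
  assumes "\<And>k. f k = (if k < length xs then xs ! k else z)" "length xs \<le> s"
  shows "f ` {..<s} - {z} = set xs - {z}"
proof (intro equalityI subsetI)
  fix y assume "y \<in> set xs - {z}"
  then obtain k where "k < length xs" "xs ! k = y" "y \<noteq> z" by (auto simp: in_set_conv_nth)
  then show "y \<in> f ` {..<s} - {z}"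
    using assms by (auto intro!: image_eqI[of _ _ k])
qed (auto simp: assms(1) split: if_splits)

text \<open>Gathering takes \<open>2 * c\<close> rounds; in two more rounds the leaders return the
  colors and the vertices announce them to all. Bins, hashes and the coloring so far are common
  knowledge, while neighbors and lists stay private.\<close>

lemma learns_phase:
  fixes E :: "'w \<Rightarrow> (nat \<times> nat) set" and \<Psi> :: "'w \<Rightarrow> nat \<Rightarrow> nat set"
    and \<beta> :: "'w \<Rightarrow> nat \<Rightarrow> nat \<times> nat" and \<gamma> :: "'w \<Rightarrow> nat \<Rightarrow> nat \<Rightarrow> nat" and s :: "'w \<Rightarrow> nat \<Rightarrow> nat" and n :: nat
  defines "N \<equiv> \<lambda>w. neighbors (E w)"
  defines "info \<equiv> \<lambda>j w v. (N w v, \<Psi> w v, (\<beta> w, \<gamma> w, s w), phase_col n (\<beta> w) (\<gamma> w) (N w) (\<Psi> w) j)"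
  assumes I: "learns n b W inp r (info j)"
    and m: "n \<le> 2 ^ m" "Suc m \<le> b"
    and coloring: "\<And>w. w \<in> W \<Longrightarrow> binned_coloring n T (E w) (\<Psi> w) (\<beta> w) (\<gamma> w)"
    and \<Psi>: "\<And>w v. w \<in> W \<Longrightarrow> v < n \<Longrightarrow> \<Psi> w v \<subseteq> {..<2 ^ m}"
    and group: "\<And>w v. w \<in> W \<Longrightarrow> v < n \<Longrightarrow> snd (\<beta> w v) < n"
    and degree: "\<And>w v. w \<in> W \<Longrightarrow> v < n \<Longrightarrow> fst (\<beta> w v) = j \<Longrightarrow>
       2 * card (bin_nbrs (\<beta> w) (N w) v) + 1 \<le> s w j"
    and size: "\<And>w i. w \<in> W \<Longrightarrow> i < n \<Longrightarrow> card (bin_class n (\<beta> w) (j, i)) * s w j \<le> c * n"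
  shows "learns n b W inp (r + 2 * c + 2) (info (Suc j))"
proof -
  define col where "col w = phase_col n (\<beta> w) (\<gamma> w) (N w) (\<Psi> w)" for w
  define nbr where "nbr w v = bin_nbrs (\<beta> w) (N w) v" for w v
  define pal where "pal w v = short_palette (\<beta> w) (\<gamma> w) (N w) (\<Psi> w) (col w j) j v" for w v
  define gl where "gl w i = sorted_list_of_set (bin_class n (\<beta> w) (j, i))" for w i
  define P where "P w v k = (if fst (\<beta> w v) = j \<and> k < length (pieces m (nbr w v) (pal w v))
      then pieces m (nbr w v) (pal w v) ! k else [])" for w v k
  have fin: "finite (bin_class n (\<beta> w) p)" for w p by (simp add: bin_class_def)
  have set_gl: "v \<in> set (gl w i) \<longleftrightarrow> v < n \<and> \<beta> w v = (j, i)" for w i v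
    unfolding gl_def using fin by (auto simp: bin_class_def)
  have nbr_less: "nbr w v \<subseteq> {..<n}" if "w \<in> W" for w v
    using binned_coloring.neighbors_less[OF coloring[OF that]]
    by (auto simp: nbr_def bin_nbrs_def N_def)
  have pal_sub: "pal w v \<subseteq> \<Psi> w v" if "w \<in> W" "v < n" for w v
    unfolding pal_def short_palette_def
    by (rule order.trans[OF shorten_subset])
      (use binned_coloring.finite_list[OF coloring[OF that(1)] that(2)]
        in \<open>auto simp: bin_palette_def free_colors_def\<close>)
  have finite: "finite (nbr w v)" "finite (pal w v)" if "w \<in> W" for w v
    using nbr_less[OF that] by (auto intro: finite_subset simp: pal_def short_palette_def)
  have length_P: "length (P w v k) \<le> b" if "w \<in> W" for w v k
  proof -
    have "length x = Suc m" if "x \<in> set (pieces m (nbr w v) (pal w v))" for x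
      using that finite[OF \<open>w \<in> W\<close>, of v] by (auto simp: set_pieces)
    then show ?thesis using m by (auto simp: P_def)
  qed
  define R where "R w i e u = (if e < c \<and> u < n \<and> (e * n + u) div s w j < length (gl w i)
            then P w (gl w i ! ((e * n + u) div s w j)) ((e * n + u) mod s w j) else [])" for w i e u
  have gather: "learns n b W inp (r + 2 * c) (\<lambda>w i. (info j w i, R w i))"
    \<comment> \<open>The pieces of \<open>v\<close> depend on neighbors and lists only at
      \<open>v\<close>, so \<open>v\<close> can compute them with constant functions in place of the
      unknown ones.\<close>
    unfolding R_def
  proof (rule learns_gather[OF I,
      where \<gamma> = "\<lambda>v (_, _, (\<beta>, _, _), _) i. sorted_list_of_set (bin_class n \<beta> (j, i))"
      and \<sigma> = "\<lambda>v (_, _, (_, _, s), _). s j"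
      and \<pi> = "\<lambda>v (N, \<Psi>, (\<beta>, \<gamma>, s), col) k.
          let B = bin_nbrs \<beta> (\<lambda>_. N) v;
              p = pieces m B (short_palette \<beta> \<gamma> (\<lambda>_. N) (\<lambda>_. \<Psi>) col j v)
          in if fst (\<beta> v) = j \<and> k < length p then p ! k else []"], goal_cases)
    case (5 w v k)
    then show ?case
      using length_P[of w v k] 
      by (auto simp: info_def P_def nbr_def pal_def short_palette_def bin_palette_def free_colors_def
          bin_nbrs_def Let_def col_def)
  qed (auto simp: info_def gl_def[symmetric] set_gl fun_eq_iff, auto simp: gl_def)

  define rec where "rec w i v = {R w i e u |e u. e < c \<and> u < n \<and> (e * n + u) div s w j < length (gl w i) \<and>
      gl w i ! ((e * n + u) div s w j) = v}" for w i v
  have rec: "{u. u < n \<and> True # bits m u \<in> rec w i v} = nbr w v"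
      "{x. x < 2 ^ m \<and> False # bits m x \<in> rec w i v} = pal w v"
    if w: "w \<in> W" "i < n" and v: "v \<in> bin_class n (\<beta> w) (j, i)" for w i v
  proof -
    have v': "v < n" "fst (\<beta> w v) = j" "v \<in> set (gl w i)"
      using v by (auto simp: set_gl bin_class_def)
    \<comment> \<open>At most \<open>d\<close> neighbors and \<open>d + 1\<close> colors, where
      \<open>d\<close> is the degree inside the bin.\<close>
    have len: "length (pieces m (nbr w v) (pal w v)) \<le> s w j"
      using degree[OF w(1) v'(1,2)] unfolding length_pieces
      by (simp add: nbr_def pal_def short_palette_def card_shorten)
    have "s w j > 0"
      using degree[OF w(1) v'(1,2)] by simp
    then have "rec w i v = P w v ` {..<s w j}"
      unfolding rec_def R_def
      by (subst range_div_mod[symmetric, of "gl w i" _ _ c n])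
        (use v' size[OF w] in \<open>auto simp: gl_def\<close>)
    also have "\<dots> - {[]} = set (pieces m (nbr w v) (pal w v)) - {[]}"
      using len by (intro image_nth_padded) (simp_all add: P_def v')
    finally have "rec w i v - {[]} =
        (\<lambda>u. True # bits m u) ` nbr w v \<union> (\<lambda>x. False # bits m x) ` pal w v"
      using finite[OF w(1)] by (auto simp: set_pieces)
    then have "x # xs \<in> rec w i v \<longleftrightarrow> x # xs \<in> (\<lambda>u. True # bits m u) ` nbr w v \<union>
        (\<lambda>x. False # bits m x) ` pal w v" for x xs
      by blast
    then have *: "True # bits m u \<in> rec w i v \<longleftrightarrow> bits m u \<in> bits m ` nbr w v"
      "False # bits m u \<in> rec w i v \<longleftrightarrow> bits m u \<in> bits m ` pal w v" for u
      by (auto simp: image_iff)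
    show "{u. u < n \<and> True # bits m u \<in> rec w i v} = nbr w v"
      using nbr_less[OF w(1), of v] m(1) unfolding * by (auto simp: bits_eq_iff)
    show "{x. x < 2 ^ m \<and> False # bits m x \<in> rec w i v} = pal w v"
      using pal_sub[OF w(1) v'(1)] \<Psi>[OF w(1) v'(1)] unfolding * by (auto simp: bits_eq_iff)
  qed

  define sol where "sol w i = local_coloring (bin_class n (\<beta> w) (j, i))
      (\<lambda>v. {u. u < n \<and> True # bits m u \<in> rec w i v})
      (\<lambda>v. {x. x < 2 ^ m \<and> False # bits m x \<in> rec w i v})" for w i
  have sol: "sol w i v = col w (Suc j) v" if "w \<in> W" "v < n" "\<beta> w v = (j, i)" for w i v
  proof -
    have "i < n" using group[OF that(1,2)] that(3) by simp
    then have "sol w i = local_coloring (bin_class n (\<beta> w) (j, i)) (nbr w) (pal w)"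
      unfolding sol_def using rec[OF that(1)] by (intro local_coloring_cong) auto
    then show ?thesis
      using that by (simp add: col_def nbr_def[abs_def] pal_def[abs_def])
  qed

  \<comment> \<open>Leader to vertex: a vertex belongs to one group and hears its color from that
    leader.\<close>
  define M where "M w i v = (if v < n \<and> \<beta> w v = (j, i) then bits m (col w (Suc j) v) else [])" for w i v
  have 1: "learns n b W inp (Suc (r + 2 * c)) (\<lambda>w v. ((info j w v, R w v), \<lambda>i. if i < n then M w i v else []))"
  proof (rule learns_round[OF gather, where \<mu> = "\<lambda>i ((_, _, (\<beta>, \<gamma>, s), _), R) v.
      if v < n \<and> \<beta> v = (j, i) then bits m (local_coloring (bin_class n \<beta> (j, i))
        (\<lambda>v. {u. u < n \<and> True # bits m u \<in> {R e u |e u. e < c \<and> u < n \<and>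
           (e * n + u) div s j < length (sorted_list_of_set (bin_class n \<beta> (j, i))) \<and>
           sorted_list_of_set (bin_class n \<beta> (j, i)) ! ((e * n + u) div s j) = v}})
        (\<lambda>v. {x. x < 2 ^ m \<and> False # bits m x \<in> {R e u |e u. e < c \<and> u < n \<and>
           (e * n + u) div s j < length (sorted_list_of_set (bin_class n \<beta> (j, i))) \<and>
           sorted_list_of_set (bin_class n \<beta> (j, i)) ! ((e * n + u) div s j) = v}}) v) else []"], goal_cases)
    case (1 w i v)
    show ?case
      using 1 m(2) sol[of w v i, unfolded sol_def rec_def gl_def]
      by (simp add: M_def info_def)
  qed
  \<comment> \<open>Vertex to everybody: a leader holds too many colors to broadcast them itself in
    one round, but each vertex holds only one.\<close>
  define M' where "M' w u v = (if fst (\<beta> w u) = j then bits m (col w (Suc j) u) else [])" for w and u v :: nat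
  have 2: "learns n b W inp (Suc (Suc (r + 2 * c))) (\<lambda>w v. (((info j w v, R w v),
     \<lambda>i. if i < n then M w i v else []), \<lambda>u. if u < n then M' w u v else []))"
  proof (rule learns_round[OF 1, where \<mu> = "\<lambda>u (((_, _, (\<beta>, \<gamma>, s), _), R), M) v.
      if fst (\<beta> u) = j then M (snd (\<beta> u)) else []"], goal_cases)
    case (1 w u v)
    then show ?case
      using group[OF 1(1,2)] m(2) by (auto simp: info_def M'_def M_def prod_eq_iff)
  qed
  show ?thesis
    unfolding add_2_eq_Suc'
  proof (rule learns_local[OF 2, where \<phi> = "\<lambda>v ((((N, \<Psi>, (\<beta>, \<gamma>, s), col), R), M), M').
      (N, \<Psi>, (\<beta>, \<gamma>, s), \<lambda>u. if u < n \<and> fst (\<beta> u) = j then bits_inv (M' u) else col u)"], goal_cases)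
    case (1 w v)
    have "bits_inv (bits m (col w (Suc j) u)) = col w (Suc j) u" if "u < n" "fst (\<beta> w u) = j" for u
    proof (rule bits_inv_bits)
      show "col w (Suc j) u < 2 ^ m"
        using binned_coloring.col_in_list[OF coloring[OF 1(1)] that(1), of "Suc j"] that \<Psi>[OF 1(1) that(1)]
        by (auto simp: col_def N_def simp del: phase_col.simps)
    qed
    then have "col w (Suc j) = (\<lambda>u. if u < n \<and> fst (\<beta> w u) = j
        then bits_inv (if u < n then M' w u v else []) else col w j u)"
      by (auto simp: fun_eq_iff col_def M'_def)
    then show ?case
      unfolding info_def col_def[symmetric] prod.case by simp
  qed
qed

section \<open>Seeded hash functions\<close>

lemma exp_le_quadratic:
  fixes t :: real
  assumes "\<bar>t\<bar> \<le> 1"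
  shows "exp t \<le> 1 + t + t\<^sup>2"
proof (cases "t \<ge> 0")
  case True
  then show ?thesis using exp_bound[of t] assms by simp
next
  case False
  define u where "u = - t"
  have u: "0 < u" "u \<le> 1" using False assms by (auto simp: u_def)
  \<comment> \<open>For \<open>t = - u\<close> the claim is
    \<open>1 \<le> (1 - u + u\<^sup>2) * exp u\<close>, and \<open>exp u\<close> is at least its
    quadratic Taylor polynomial.\<close>
  have "1 \<le> (1 - u + u\<^sup>2) * (1 + u + u\<^sup>2 / 2)"
  proof -
    have "(1 - u + u\<^sup>2) * (1 + u + u\<^sup>2 / 2) = 1 + (u\<^sup>2 + u ^ 3 + u ^ 4) / 2"
      by (simp add: field_simps power2_eq_square power3_eq_cube power4_eq_xxxx)
    then show ?thesis using u by simp
  qed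
  also have "\<dots> \<le> (1 - u + u\<^sup>2) * exp u"
    using exp_lower_Taylor_quadratic[of u] u by (intro mult_left_mono) (auto simp: add_nonneg_nonneg)
  finally show ?thesis
    using u by (simp add: exp_minus field_simps u_def)
qed

text \<open>Markov's inequality for the exponential of \<open>t\<close> times the count, which
  factorizes by independence. Since \<open>t\<close> may have either sign, this covers both
  tails.\<close>

lemma Pi_pmf_Chernoff_aux:
  fixes \<beta> :: "'b pmf" and t r :: real and A :: "'b set"
  assumes "finite U" "S \<subseteq> U" "\<bar>t\<bar> \<le> 1"
  defines "p \<equiv> measure_pmf.prob \<beta> A"
  shows "measure_pmf.prob (Pi_pmf U d (\<lambda>_. \<beta>))
           {h. t * real (card {x \<in> S. h x \<in> A}) \<ge> t * (p * real (card S)) + r}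
         \<le> exp (t\<^sup>2 * (p * real (card S)) - r)"
proof -
  define f where "f x y = (if x \<in> S \<and> y \<in> A then exp t else 1)" for x :: 'a and y
  have finS: "finite S" using assms finite_subset by blast
  have f_eq: "f x y = (if x \<in> S then 1 + (exp t - 1) * indicator A y else 1)" for x y
    by (auto simp: f_def)
  have prod_f: "(\<Prod>x\<in>U. f x (h x)) = exp (t * real (card {x \<in> S. h x \<in> A}))" for h
  proof -
    have "(\<Prod>x\<in>U. f x (h x)) = (\<Prod>x\<in>{x\<in>S. h x \<in> A}. exp t)"
      using assms(1,2) by (intro prod.mono_neutral_cong_right) (auto simp: f_def)
    then show ?thesis by (simp add: exp_of_nat2_mult)
  qed
  have "measure_pmf.expectation (Pi_pmf U d (\<lambda>_. \<beta>)) (\<lambda>h. \<Prod>x\<in>U. f x (h x)) =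
      (\<Prod>x\<in>U. measure_pmf.expectation \<beta> (f x))"
    by (rule expectation_prod_Pi_pmf) (auto simp: assms f_def intro!: measure_pmf.integrable_const_bound[where B = "max 1 (exp t)"])
  also have "\<dots> = (\<Prod>x\<in>U. if x \<in> S then 1 + p * (exp t - 1) else 1)"
    by (intro prod.cong) (auto simp: f_eq[abs_def] p_def measure_pmf.emeasure_eq_measure)
  also have "\<dots> = (1 + p * (exp t - 1)) ^ card S"
    using assms(1,2) by (simp add: prod.If_cases Int_absorb1)
  also have "\<dots> \<le> exp (p * (exp t - 1)) ^ card S"
  proof (intro power_mono)
    have "0 \<le> p" "p \<le> 1" by (auto simp: p_def)
    then have "0 \<le> (1 - p) + p * exp t" by (intro add_nonneg_nonneg) auto
    then show "0 \<le> 1 + p * (exp t - 1)" by (simp add: algebra_simps)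
  qed (use exp_ge_add_one_self in auto)
  also have "\<dots> = exp (p * card S * (exp t - 1))"
    by (simp add: exp_of_nat2_mult[symmetric] mult_ac)
  also have "\<dots> \<le> exp (p * card S * (t + t\<^sup>2))"
    using exp_le_quadratic[OF assms(3)] by (auto intro!: mult_left_mono simp: p_def)
  finally have mgf: "measure_pmf.expectation (Pi_pmf U d (\<lambda>_. \<beta>)) (\<lambda>h. \<Prod>x\<in>U. f x (h x)) \<le>
    exp (p * card S * (t + t\<^sup>2))" .
  define c where "c = exp (t * (p * real (card S)) + r)"
  have "integrable (measure_pmf (Pi_pmf U d (\<lambda>_. \<beta>))) (\<lambda>h. \<Prod>x\<in>U. f x (h x))"
    by (rule integrable_prod_Pi_pmf[OF assms(1)])
      (auto simp: f_def intro!: measure_pmf.integrable_const_bound[where B = "max 1 (exp t)"])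
  then have "measure_pmf.prob (Pi_pmf U d (\<lambda>_. \<beta>)) {h\<in>space (measure_pmf (Pi_pmf U d (\<lambda>_. \<beta>))).
      c \<le> (\<Prod>x\<in>U. f x (h x))} \<le>
      measure_pmf.expectation (Pi_pmf U d (\<lambda>_. \<beta>)) (\<lambda>h. \<Prod>x\<in>U. f x (h x)) / c"
    by (rule integral_Markov_inequality_measure[where A = "{}"])
      (auto simp: c_def intro!: prod_nonneg simp: f_def)
  also have "\<dots> \<le> exp (p * card S * (t + t\<^sup>2)) / c"
    using mgf by (intro divide_right_mono) (auto simp: c_def)
  also have "\<dots> = exp (t\<^sup>2 * (p * real (card S)) - r)"
    unfolding c_def exp_diff[symmetric] by (simp add: algebra_simps)
  finally show ?thesis
    by (simp add: prod_f c_def)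
qed

text \<open>For a mean \<open>M \<ge> y\<close> the threshold is \<open>2 * sqrt (y * M)\<close>,
  the Gaussian range; for smaller means it is \<open>2 * y\<close>. Either way the probability is at
  most \<open>2 * exp (- y)\<close>, so one parameter \<open>y\<close> serves counts of all
  sizes.\<close>

definition deviates :: "real \<Rightarrow> 'b pmf \<Rightarrow> 'b set \<Rightarrow> 'a set \<Rightarrow> ('a \<Rightarrow> 'b) \<Rightarrow> bool" where
  "deviates y \<beta> A S h \<longleftrightarrow>
     \<bar>real (card {x \<in> S. h x \<in> A}) - measure_pmf.prob \<beta> A * real (card S)\<bar>
       \<ge> 2 * sqrt (y * max (measure_pmf.prob \<beta> A * real (card S)) y)"

lemma Pi_pmf_Chernoff:
  assumes "finite U" "S \<subseteq> U" "y > 0"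
  shows "measure_pmf.prob (Pi_pmf U d (\<lambda>_. \<beta>)) {h. deviates y \<beta> A S h} \<le> 2 * exp (- y)"
proof -
  define M where "M = measure_pmf.prob \<beta> A * real (card S)"
  define \<mu> where "\<mu> = max M y"
  \<comment> \<open>With this choice \<open>t \<le> 1\<close>, \<open>t\<^sup>2 * M \<le> y\<close>,
    and \<open>t\<close> times the threshold is \<open>2 * y\<close>; the exponent is then at most
    \<open>y - 2 * y\<close>.\<close>
  define t where "t = sqrt (y / \<mu>)"
  have \<mu>: "\<mu> > 0" "M \<le> \<mu>" "y \<le> \<mu>" using assms by (auto simp: \<mu>_def)
  have t: "0 < t" "t \<le> 1" using \<mu> assms by (auto simp: t_def)
  have tt: "t\<^sup>2 * M \<le> y"
    using \<mu> assms by (simp add: t_def field_simps mult_left_mono)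
  have ts: "t * (2 * sqrt (y * \<mu>)) = 2 * y"
    using \<mu> assms by (simp add: t_def real_sqrt_mult[symmetric] mult_ac)
  let ?P = "measure_pmf.prob (Pi_pmf U d (\<lambda>_. \<beta>))"
  let ?X = "\<lambda>h. real (card {x \<in> S. h x \<in> A})"
  have *: "?P {h. s * ?X h \<ge> s * M + 2 * y} \<le> exp (- y)" if "\<bar>s\<bar> = t" for s
  proof -
    have "?P {h. s * ?X h \<ge> s * M + 2 * y} \<le> exp (s\<^sup>2 * M - 2 * y)"
      unfolding M_def by (rule Pi_pmf_Chernoff_aux) (use assms t that in auto)
    also have "s\<^sup>2 = t\<^sup>2" using that by (metis power2_abs)
    also have "exp (t\<^sup>2 * M - 2 * y) \<le> exp (- y)" using tt by simp
    finally show ?thesis .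
  qed
  have "{h. deviates y \<beta> A S h} \<subseteq> {h. t * ?X h \<ge> t * M + 2 * y} \<union> {h. - t * ?X h \<ge> - t * M + 2 * y}"
  proof
    fix h assume "h \<in> {h. deviates y \<beta> A S h}"
    then have "\<bar>?X h - M\<bar> \<ge> 2 * sqrt (y * \<mu>)" by (simp add: deviates_def M_def \<mu>_def)
    then have "t * \<bar>?X h - M\<bar> \<ge> 2 * y" using t ts by (metis less_imp_le mult_left_mono)
    then show "h \<in> {h. t * ?X h \<ge> t * M + 2 * y} \<union> {h. - t * ?X h \<ge> - t * M + 2 * y}"
      by (auto simp: abs_if algebra_simps split: if_splits)
  qed
  then have "?P {h. deviates y \<beta> A S h} \<le> ?P ({h. t * ?X h \<ge> t * M + 2 * y} \<union> {h. - t * ?X h \<ge> - t * M + 2 * y})"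
    by (intro measure_pmf.finite_measure_mono) auto
  also have "\<dots> \<le> ?P {h. t * ?X h \<ge> t * M + 2 * y} + ?P {h. - t * ?X h \<ge> - t * M + 2 * y}"
    by (intro measure_Un_le) auto
  also have "\<dots> \<le> exp (- y) + exp (- y)"
    using *[of t] *[of "- t"] t by (intro add_mono) auto
  finally show ?thesis by simp
qed

text \<open>
  Newman's argument: a list of random values that is a little longer than the logarithm of the number
  of inputs represents the distribution \<open>R\<close> for all inputs simultaneously, so that a short seed
  suffices to sample from it.
\<close>

lemma Newman:
  fixes R :: "'r pmf" and bad :: "'x \<Rightarrow> 'r \<Rightarrow> bool"
  assumes I: "finite I" and X: "finite X" "card X \<le> 2 ^ t"
    and p: "\<And>x. x \<in> X \<Longrightarrow> measure_pmf.prob R {r. bad x r} \<le> p" "0 \<le> p" "2 * real (card I) * p \<le> 1"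
  obtains H where "\<And>i. i \<in> I \<Longrightarrow> H i \<in> set_pmf R" "\<And>x. x \<in> X \<Longrightarrow> card {i \<in> I. bad x (H i)} \<le> t"
proof -
  define Q where "Q = Pi_pmf I (undefined :: 'r) (\<lambda>_. R)"
  define J where "J = {J. J \<subseteq> I \<and> card J = Suc t}"
  have finJ: "finite J" using I by (auto simp: J_def)
  define F where "F x = {H. card {i \<in> I. bad x (H i)} > t}" for x
  have F: "measure_pmf.prob Q (F x) \<le> (1 / 2) ^ Suc t" if x: "x \<in> X" for x
  proof -
    \<comment> \<open>If more than \<open>t\<close> values are bad for \<open>x\<close>, then all
      values with indices in some set \<open>K\<close> of size \<open>t + 1\<close> are bad. The
      union bound over these \<open>K\<close> gives at most
      \<open>(card I * p) ^ (t + 1)\<close>.\<close>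
    define B where "B K = Pi I (\<lambda>i. if i \<in> K then {r. bad x r} else UNIV)" for K
    have "F x \<subseteq> (\<Union>K\<in>J. B K)"
    proof
      fix H assume "H \<in> F x"
      then have "Suc t \<le> card {i \<in> I. bad x (H i)}" by (simp add: F_def)
      then obtain K where "K \<subseteq> {i \<in> I. bad x (H i)}" "card K = Suc t"
        by (meson obtain_subset_with_card_n)
      then have "K \<in> J" "H \<in> B K" by (auto simp: J_def B_def)
      then show "H \<in> (\<Union>K\<in>J. B K)" by blast
    qed
    then have "measure_pmf.prob Q (F x) \<le> measure_pmf.prob Q (\<Union>K\<in>J. B K)"
      by (intro measure_pmf.finite_measure_mono) auto
    also have "\<dots> \<le> (\<Sum>K\<in>J. measure_pmf.prob Q (B K))"
      by (rule measure_pmf.finite_measure_subadditive_finite[OF finJ]) auto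
    also have "\<dots> \<le> (\<Sum>K\<in>J. p ^ Suc t)"
    proof (rule sum_mono)
      fix K assume K: "K \<in> J"
      have "measure_pmf.prob Q (B K) = (\<Prod>i\<in>I. measure_pmf.prob R (if i \<in> K then {r. bad x r} else UNIV))"
        unfolding Q_def B_def by (rule measure_Pi_pmf_Pi[OF I])
      also have "\<dots> = (\<Prod>i\<in>K. measure_pmf.prob R {r. bad x r})"
        using K I by (intro prod.mono_neutral_cong_right) (auto simp: J_def)
      also have "\<dots> \<le> p ^ Suc t"
        using K p(1)[OF x] by (auto simp: J_def intro!: power_mono simp del: power_Suc)
      finally show "measure_pmf.prob Q (B K) \<le> p ^ Suc t" .
    qed
    also have "\<dots> = real (card I choose Suc t) * p ^ Suc t"
      using n_subsets[OF I, of "Suc t"] by (simp add: J_def)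
    also have "\<dots> \<le> real (card I) ^ Suc t * p ^ Suc t"
    proof (intro mult_right_mono)
      show "real (card I choose Suc t) \<le> real (card I) ^ Suc t"
        by (cases "Suc t \<le> card I")
          (use binomial_le_pow[of "Suc t" "card I"] in \<open>simp_all add: of_nat_power[symmetric] binomial_eq_0 del: of_nat_power power_Suc\<close>)
    qed (use p in auto)
    also have "\<dots> = (real (card I) * p) ^ Suc t" by (simp add: power_mult_distrib)
    also have "\<dots> \<le> (1 / 2) ^ Suc t" using p by (intro power_mono) auto
    finally show ?thesis .
  qed
  have "measure_pmf.prob Q (\<Union>x\<in>X. F x) \<le> (\<Sum>x\<in>X. measure_pmf.prob Q (F x))"
    by (rule measure_pmf.finite_measure_subadditive_finite[OF X(1)]) auto
  also have "\<dots> \<le> (\<Sum>x\<in>X. (1 / 2) ^ Suc t)" by (intro sum_mono F)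
  also have "\<dots> = real (card X) * (1 / 2) ^ Suc t" by simp
  also have "\<dots> \<le> 2 ^ t * (1 / 2) ^ Suc t"
    using X(2) by (intro mult_right_mono) (metis of_nat_le_iff of_nat_numeral of_nat_power, simp)
  \<comment> \<open>Failure means at least \<open>t + 1\<close> bad values; the extra one supplies
    the factor 1/2 that beats \<open>2 ^ t\<close> inputs.\<close>
  also have "\<dots> < 1" by (simp add: power_divide)
  finally have "measure_pmf.prob Q (\<Union>x\<in>X. F x) < 1" .
  moreover have "measure_pmf.prob Q (\<Union>x\<in>X. F x) = 1" if "set_pmf Q \<subseteq> (\<Union>x\<in>X. F x)"
    using that by (subst measure_pmf.prob_eq_1) (auto simp: AE_measure_pmf_iff)
  ultimately obtain H where H: "H \<in> set_pmf Q" "H \<notin> (\<Union>x\<in>X. F x)" by (metis less_irrefl subsetI)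
  show ?thesis
  proof (rule that[of H])
    show "H i \<in> set_pmf R" if "i \<in> I" for i
      using H(1) that unfolding Q_def set_Pi_pmf[OF I] by (auto simp: PiE_dflt_def)
    show "card {i \<in> I. bad x (H i)} \<le> t" if "x \<in> X" for x
      using H(2) that by (auto simp: F_def not_less)
  qed
qed

text \<open>\<open>Newman\<close> applied with the subsets of \<open>U\<close> as inputs. There are
  \<open>2 ^ card U\<close> of them, so at most \<open>card U\<close> of the \<open>2 ^ m\<close>
  seeds are bad for any given subset. The last assumption is \<open>2 * card I * p \<le> 1\<close>
  for the failure probability \<open>p = 2 * card \<A> * exp (- y)\<close> of a fully random
  function.\<close>

lemma hash_family:
  fixes \<beta> :: "'b pmf" and U :: "'a set"
  assumes "finite U" "finite \<A>" "y > 0" "2 ^ m * (4 * real (card \<A>) * exp (- y)) \<le> 1"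
  shows "\<exists>H :: bool list \<Rightarrow> 'a \<Rightarrow> 'b.
    (\<forall>bs x. length bs = m \<longrightarrow> x \<in> U \<longrightarrow> H bs x \<in> set_pmf \<beta>) \<and>
    (\<forall>S\<subseteq>U. measure_pmf.prob (pmf_of_set {bs. length bs = m})
        {bs. \<exists>A\<in>\<A>. deviates y \<beta> A S (H bs)} \<le> real (card U) / 2 ^ m)"
proof -
  define I where "I = {bs :: bool list. length bs = m}"
  have I: "I = {bs. set bs \<subseteq> UNIV \<and> length bs = m}" by (auto simp: I_def)
  have finI: "finite I" unfolding I by (rule finite_lists_length_eq) simp
  have cardI: "card I = 2 ^ m" unfolding I by (subst card_lists_length_eq) simp_all
  obtain H where H: "\<And>i. i \<in> I \<Longrightarrow> H i \<in> set_pmf (Pi_pmf U (undefined :: 'b) (\<lambda>_. \<beta>))"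
    "\<And>S. S \<in> Pow U \<Longrightarrow> card {i \<in> I. \<exists>A\<in>\<A>. deviates y \<beta> A S (H i)} \<le> card U"
  proof (rule Newman[where I = I and X = "Pow U" and t = "card U" and p = "2 * real (card \<A>) * exp (- y)"
        and R = "Pi_pmf U (undefined :: 'b) (\<lambda>_. \<beta>)" and bad = "\<lambda>S h. \<exists>A\<in>\<A>. deviates y \<beta> A S h"])
    fix S assume S: "S \<in> Pow U"
    have "measure_pmf.prob (Pi_pmf U undefined (\<lambda>_. \<beta>)) (\<Union>A\<in>\<A>. {h. deviates y \<beta> A S h}) \<le>
        (\<Sum>A\<in>\<A>. measure_pmf.prob (Pi_pmf U undefined (\<lambda>_. \<beta>)) {h. deviates y \<beta> A S h})"
      by (rule measure_pmf.finite_measure_subadditive_finite[OF assms(2)]) auto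
    also have "\<dots> \<le> (\<Sum>A\<in>\<A>. 2 * exp (- y))"
      using S assms by (intro sum_mono Pi_pmf_Chernoff) auto
    finally show "measure_pmf.prob (Pi_pmf U undefined (\<lambda>_. \<beta>)) {h. \<exists>A\<in>\<A>. deviates y \<beta> A S h} \<le>
        2 * real (card \<A>) * exp (- y)"
      by (simp add: UN_iff[symmetric] Collect_bex_eq mult_ac)
  qed (use assms finI in \<open>auto simp: cardI card_Pow mult_ac\<close>)
  show ?thesis
  proof (rule exI[of _ H], intro conjI allI impI)
    show "H bs x \<in> set_pmf \<beta>" if "length bs = m" "x \<in> U" for bs x
      using H(1)[of bs] that unfolding set_Pi_pmf[OF assms(1)] by (auto simp: I_def PiE_dflt_def)
    show "measure_pmf.prob (pmf_of_set {bs. length bs = m}) {bs. \<exists>A\<in>\<A>. deviates y \<beta> A S (H bs)}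
        \<le> real (card U) / 2 ^ m" if "S \<subseteq> U" for S
    proof -
      have "I \<noteq> {}" using cardI by auto
      then have "measure_pmf.prob (pmf_of_set I) {bs. \<exists>A\<in>\<A>. deviates y \<beta> A S (H bs)} =
          real (card (I \<inter> {bs. \<exists>A\<in>\<A>. deviates y \<beta> A S (H bs)})) / 2 ^ m"
        using finI cardI by (subst measure_pmf_of_set) simp_all
      also have "I \<inter> {bs. \<exists>A\<in>\<A>. deviates y \<beta> A S (H bs)} = {i \<in> I. \<exists>A\<in>\<A>. deviates y \<beta> A S (H i)}"
        by blast
      finally show ?thesis
        using H(2)[of S] that by (simp add: I_def[symmetric] divide_right_mono)
    qed
  qed
qed

text \<open>Condition on the coins of all processors but \<open>j\<close>. The event may depend on
  them arbitrarily, as it does when the hashed set was shaped by earlier seeds.\<close>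

lemma prob_coin_flips_le:
  assumes "j < n"
    and "\<And>f. measure_pmf.prob (pmf_of_set {bs. length bs = m}) {bs. f(j := bs) \<in> F} \<le> \<delta>"
  shows "measure_pmf.prob (coin_flips n m) F \<le> \<delta>"
proof -
  let ?Q = "Pi_pmf ({..<n} - {j}) [] (\<lambda>_. pmf_of_set {bs :: bool list. length bs = m})"
  have "coin_flips n m = Pi_pmf (insert j ({..<n} - {j})) [] (\<lambda>_. pmf_of_set {bs :: bool list. length bs = m})"
    unfolding coin_flips_def using assms(1) by (intro Pi_pmf_cong) auto
  also have "\<dots> = bind_pmf ?Q (\<lambda>f. map_pmf (\<lambda>bs. f(j := bs)) (pmf_of_set {bs. length bs = m}))"
    by (subst Pi_pmf_insert', simp, simp, subst bind_commute_pmf) (simp add: map_pmf_def)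
  finally have *: "coin_flips n m = \<dots>" .
  have "emeasure (coin_flips n m) F \<le> ennreal \<delta>"
  proof -
    have "\<delta> \<ge> 0" using assms(2) measure_nonneg order.trans by blast
    have "emeasure (coin_flips n m) F = (\<integral>\<^sup>+f. emeasure (map_pmf (\<lambda>bs. f(j := bs)) (pmf_of_set {bs. length bs = m})) F \<partial>?Q)"
      unfolding * by (rule emeasure_bind_pmf)
    also have "\<dots> \<le> (\<integral>\<^sup>+f. ennreal \<delta> \<partial>?Q)"
      using assms(2) by (intro nn_integral_mono)
        (auto simp: measure_pmf.emeasure_eq_measure vimage_def intro!: ennreal_leI)
    also have "\<dots> = ennreal \<delta>" by simp
    finally show ?thesis .
  qed
  moreover have "\<delta> \<ge> 0" using assms(2) measure_nonneg order.trans by blast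
  ultimately show ?thesis by (simp add: measure_pmf.emeasure_eq_measure)
qed

section \<open>The whole protocol and the distribution of the bins\<close>

text \<open>The worlds in which the protocol is required to work. The coins of processor 0 select
  the vertex bins and those of processor \<open>j + 1\<close> the color hash of phase
  \<open>j\<close>, so that the phases have independent seeds.\<close>

definition good_worlds :: "nat \<Rightarrow> nat \<Rightarrow> nat \<Rightarrow> nat \<Rightarrow> nat \<Rightarrow> (nat \<Rightarrow> bool list \<Rightarrow> nat \<Rightarrow> nat \<times> nat) \<Rightarrow>
    (nat \<Rightarrow> nat \<Rightarrow> bool list \<Rightarrow> nat \<Rightarrow> nat) \<Rightarrow> (nat \<Rightarrow> nat \<Rightarrow> nat) \<Rightarrow>
    ((nat \<times> nat) set \<times> (nat \<Rightarrow> nat set) \<times> (nat \<Rightarrow> bool list)) set" where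
  "good_worlds n T m k c B C s = {(E, \<Psi>, \<omega>).
     list_coloring_instance {..<n} E \<Psi> \<and> (\<forall>v<n. \<Psi> v \<subseteq> {..<2 ^ k}) \<and>
     (\<forall>v<n. length (\<omega> v) = m) \<and> (\<forall>v\<ge>n. \<omega> v = []) \<and>
     (let \<Delta> = max_degree {..<n} E; \<beta> = B \<Delta> (\<omega> 0); \<gamma> = (\<lambda>j. C \<Delta> j (\<omega> (Suc j))) in
       binned_coloring n T E \<Psi> \<beta> \<gamma> \<and>
       (\<forall>v<n. snd (\<beta> v) < n \<and> 2 * card (bin_nbrs \<beta> (neighbors E) v) + 1 \<le> s \<Delta> (fst (\<beta> v))) \<and>
       (\<forall>j<T. \<forall>i<n. card (bin_class n \<beta> (j, i)) * s \<Delta> j \<le> c * n))}"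

definition seeded_col :: "nat \<Rightarrow> nat \<Rightarrow> (nat \<Rightarrow> bool list \<Rightarrow> nat \<Rightarrow> nat \<times> nat) \<Rightarrow>
    (nat \<Rightarrow> nat \<Rightarrow> bool list \<Rightarrow> nat \<Rightarrow> nat) \<Rightarrow> (nat \<times> nat) set \<times> (nat \<Rightarrow> nat set) \<times> (nat \<Rightarrow> bool list) \<Rightarrow>
    nat \<Rightarrow> nat" where
  "seeded_col n T B C = (\<lambda>(E, \<Psi>, \<omega>). phase_col n (B (max_degree {..<n} E) (\<omega> 0))
     (\<lambda>j. C (max_degree {..<n} E) j (\<omega> (Suc j))) (neighbors E) \<Psi> T)"

lemma learns_coloring:
  fixes n T m k c b
  assumes "n \<le> 2 ^ k" "Suc k \<le> b" "m \<le> b"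
  shows "learns n b (good_worlds n T m k c B C s) (\<lambda>(E, \<Psi>, \<omega>) v. (local_input E \<Psi> v, \<omega> v))
     (1 + T * (2 * c + 2)) (seeded_col n T B C)"
    (is "learns n b ?W ?inp _ _")
proof -
  define \<Delta> where "\<Delta> = (\<lambda>(E, \<Psi> :: nat \<Rightarrow> nat set, \<omega> :: nat \<Rightarrow> bool list). max_degree {..<n} E)"
  define E where "E = (\<lambda>(E :: (nat \<times> nat) set, \<Psi> :: nat \<Rightarrow> nat set, \<omega> :: nat \<Rightarrow> bool list). E)"
  define \<Psi> where "\<Psi> = (\<lambda>(E :: (nat \<times> nat) set, \<Psi> :: nat \<Rightarrow> nat set, \<omega> :: nat \<Rightarrow> bool list). \<Psi>)"
  define \<omega> where "\<omega> = (\<lambda>(E :: (nat \<times> nat) set, \<Psi> :: nat \<Rightarrow> nat set, \<omega> :: nat \<Rightarrow> bool list). \<omega>)"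
  define \<beta> where "\<beta> w = B (\<Delta> w) (\<omega> w 0)" for w
  define \<gamma> where "\<gamma> w j = C (\<Delta> w) j (\<omega> w (Suc j))" for w j
  define info where "info j w v = (neighbors (E w) v, \<Psi> w v, (\<beta> w, \<gamma> w, s (\<Delta> w)),
    phase_col n (\<beta> w) (\<gamma> w) (neighbors (E w)) (\<Psi> w) j)" for j w v
  note defs = \<Delta>_def E_def \<Psi>_def \<omega>_def
  have "learns n b ?W ?inp (Suc 0) (\<lambda>w v. (?inp w v, \<lambda>u. if u < n then \<omega> w u else []))"
    by (rule learns_round[OF learns_input, where \<mu> = "\<lambda>u a v. snd a"])
      (use assms in \<open>auto simp: good_worlds_def defs\<close>)
  then have "learns n b ?W ?inp 1 (info 0)"
    unfolding One_nat_def
  \<comment> \<open>The maximum degree is read off the length of the own list, without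
    communication.\<close>
  proof (rule learns_local[where \<phi> = "\<lambda>v (((N, \<Psi>), _), \<omega>). (N, \<Psi>,
      (B (card \<Psi> - 1) (\<omega> 0), (\<lambda>j. C (card \<Psi> - 1) j (\<omega> (Suc j))), s (card \<Psi> - 1)), (\<lambda>_. 0))"], goal_cases)
    case (1 w v)
    obtain E' \<Psi>' \<omega>' where w: "w = (E', \<Psi>', \<omega>')" by (cases w)
    have "card (\<Psi>' v) = Suc (max_degree {..<n} E')" "\<And>u. \<not> u < n \<Longrightarrow> \<omega>' u = []"
      using 1 by (auto simp: w good_worlds_def list_coloring_instance_def)
    then have "card (\<Psi>' v) - 1 = max_degree {..<n} E'"
      "(\<lambda>u. if u < n then \<omega> (E', \<Psi>', \<omega>') u else []) = \<omega>'"
      by (auto simp: \<omega>_def)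
    then show ?case
      unfolding w by (simp add: info_def \<beta>_def[abs_def] \<gamma>_def[abs_def] local_input_def defs)
  qed
  then have "learns n b ?W ?inp (1 + j * (2 * c + 2)) (info j)" if "j \<le> T" for j
    using that
  proof (induction j)
    case (Suc j)
    then have IH: "learns n b ?W ?inp (1 + j * (2 * c + 2)) (info j)" by simp
    have "learns n b ?W ?inp (1 + j * (2 * c + 2) + 2 * c + 2) (info (Suc j))"
      unfolding info_def
      by (rule learns_phase[OF IH[unfolded info_def] assms(1,2), where T = T])
        (use Suc.prems in \<open>auto simp: good_worlds_def Let_def \<beta>_def \<gamma>_def[abs_def] defs\<close>)
    then show ?case by (simp add: algebra_simps)
  qed simp
  from learns_local[OF this[OF order_refl], where \<phi> = "\<lambda>v (_, _, _, col). col v" and J = "seeded_col n T B C"]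
  show ?thesis
    by (auto simp: info_def seeded_col_def \<beta>_def \<gamma>_def[abs_def] defs)
qed

section \<open>Free colors and neighbors\<close>

lemma card_free_colors:
  assumes "finite (N v)" "finite (\<Psi> v)"
  shows "card (\<Psi> v) \<le> card (free_colors \<beta> N \<Psi> f j v) + card {u \<in> N v. fst (\<beta> u) < j}"
proof -
  have "\<Psi> v \<subseteq> free_colors \<beta> N \<Psi> f j v \<union> f ` {u \<in> N v. fst (\<beta> u) < j}"
    by (auto simp: free_colors_def)
  then have "card (\<Psi> v) \<le> card (free_colors \<beta> N \<Psi> f j v \<union> f ` {u \<in> N v. fst (\<beta> u) < j})"
    using assms by (intro card_mono) (auto simp: free_colors_def)
  also have "\<dots> \<le> card (free_colors \<beta> N \<Psi> f j v) + card (f ` {u \<in> N v. fst (\<beta> u) < j})"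
    by (rule card_Un_le)
  also have "card (f ` {u \<in> N v. fst (\<beta> u) < j}) \<le> card {u \<in> N v. fst (\<beta> u) < j}"
    using assms by (intro card_image_le) auto
  finally show ?thesis by simp
qed

text \<open>A neighbor colored earlier removes at most one color, but it also leaves the degree in
  the bin; the surplus of the original list therefore persists.\<close>

lemma last_phase_slack:
  assumes "finite (N v)" "finite (\<Psi> v)" "card (N v) < card (\<Psi> v)" "fst (\<beta> v) = j"
    "\<And>c. c \<in> \<Psi> v \<Longrightarrow> \<gamma> j c = snd (\<beta> v)"
  shows "card (bin_nbrs \<beta> N v) < card (bin_palette \<beta> \<gamma> N \<Psi> f j v)"
proof -
  have "bin_palette \<beta> \<gamma> N \<Psi> f j v = free_colors \<beta> N \<Psi> f j v"
    using assms(5) by (auto simp: bin_palette_def free_colors_def)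
  moreover have "card (bin_nbrs \<beta> N v) + card {u \<in> N v. fst (\<beta> u) < j} \<le> card (N v)"
    using assms(1,4)
    by (subst card_Un_disjoint[symmetric]) (auto simp: bin_nbrs_def intro!: card_mono)
  ultimately show ?thesis
    using card_free_colors[where N = N and \<Psi> = \<Psi> and v = v, OF assms(1,2), of \<beta> f j] assms(3) by simp
qed

lemma max_degree_bounds:
  assumes "simple_graph {..<n} E" "v < n"
  shows "finite (neighbors E v)" "neighbors E v \<subseteq> {..<n}"
    "card (neighbors E v) \<le> max_degree {..<n} E" "max_degree {..<n} E \<le> n"
proof -
  have sub: "neighbors E u \<subseteq> {..<n}" for u
    using assms(1) by (auto simp: simple_graph_def neighbors_def)
  then show "neighbors E v \<subseteq> {..<n}" "finite (neighbors E v)"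
    using finite_subset by blast+
  show "card (neighbors E v) \<le> max_degree {..<n} E"
    unfolding max_degree_def using assms(2) by (intro Max_ge) auto
  have "card (neighbors E u) \<le> n" for u
    using card_mono[OF _ sub[of u]] by simp
  then show "max_degree {..<n} E \<le> n"
    unfolding max_degree_def using assms(2) by (subst Max_le_iff) auto
qed

section \<open>The distribution of phases and groups\<close>

lemma prob_geometric_atLeast:
  assumes "0 < q" "q < 1"
  shows "measure_pmf.prob (geometric_pmf (1 - q)) {j..} = q ^ j"
proof -
  have "measure_pmf.prob (geometric_pmf (1 - q)) {..<j} = (\<Sum>i<j. q ^ i * (1 - q))"
    using assms by (simp add: measure_measure_pmf_finite)
  also have "\<dots> = 1 - q ^ j"
    using assms by (subst sum_distrib_right[symmetric]) (simp add: one_diff_power_eq mult.commute)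
  finally have "measure_pmf.prob (geometric_pmf (1 - q)) (UNIV - {..<j}) = q ^ j"
    using measure_pmf.prob_compl[of "{..<j}" "geometric_pmf (1 - q)"] by simp
  then show ?thesis by (simp add: Compl_eq_Diff_UNIV[symmetric])
qed

text \<open>The number of phases survived is geometric; truncation at 4 sends everything that
  survives four phases to the last one.\<close>

definition bin_pmf :: "real \<Rightarrow> (nat \<Rightarrow> nat) \<Rightarrow> (nat \<times> nat) pmf" where
  "bin_pmf q k = bind_pmf (map_pmf (min 4) (geometric_pmf (1 - q)))
     (\<lambda>j. map_pmf (Pair j) (pmf_of_set {..<k j}))"

lemma set_bin_pmf:
  assumes "\<And>j. k j > 0" "p \<in> set_pmf (bin_pmf q k)"
  shows "fst p \<le> 4" "snd p < k (fst p)"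
  using assms(2) by (auto simp: bin_pmf_def set_pmf_of_set assms(1) lessThan_empty_iff
      intro!: assms(1) simp del: min_less_iff_conj)

lemma prob_bin_pmf_phase:
  assumes "0 < q" "q < 1" "j \<le> 4"
  shows "measure_pmf.prob (bin_pmf q k) {p. j \<le> fst p} = q ^ j"
proof -
  have "map_pmf fst (bin_pmf q k) = map_pmf (min 4) (geometric_pmf (1 - q))"
    unfolding bin_pmf_def map_bind_pmf map_pmf_comp by (simp add: bind_return_pmf')
  then have "measure_pmf.prob (bin_pmf q k) (fst -` {j..}) =
      measure_pmf.prob (geometric_pmf (1 - q)) (min 4 -` {j..})"
    by (metis measure_map_pmf)
  also have "min 4 -` {j..} = {j..}" using assms(3) by auto
  finally show ?thesis
    using prob_geometric_atLeast[OF assms(1,2)] by (simp add: vimage_def)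
qed

lemma prob_bin_pmf_bin:
  assumes "0 < q" "q < 1" "j < 4" "b < k j"
  shows "measure_pmf.prob (bin_pmf q k) {(j, b)} = q ^ j * (1 - q) / real (k j)"
proof -
  have "pmf (map_pmf (Pair i) (pmf_of_set {..<k i})) (j, b) = indicator {j} i * (1 / real (k j))" for i
  proof (cases "i = j")
    case True
    then show ?thesis
      using assms(4) by (subst True, subst pmf_map_inj') (auto simp: inj_def lessThan_empty_iff)
  next
    case False
    then show ?thesis by (auto simp: pmf_eq_0_set_pmf)
  qed
  then have "pmf (bin_pmf q k) (j, b) =
      measure_pmf.prob (map_pmf (min 4) (geometric_pmf (1 - q))) {j} * (1 / real (k j))"
    unfolding bin_pmf_def pmf_bind by simp
  also have "measure_pmf.prob (map_pmf (min 4) (geometric_pmf (1 - q))) {j} =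
      measure_pmf.prob (geometric_pmf (1 - q)) (min 4 -` {j})"
    by simp
  also have "min 4 -` {j} = {j}" using assms(3) by (auto simp: min_def split: if_splits)
  finally show ?thesis using assms by (simp add: measure_pmf_single)
qed

section \<open>Parameters of the phases\<close>

text \<open>
  A vertex survives each phase with probability \<open>q\<close>. A group of phase \<open>j\<close> then has about
  \<open>n / sqrt \<Delta>\<close> vertices, of degree about \<open>sqrt \<Delta>\<close>, in total size \<open>O(n)\<close>. The lower bound
  \<open>\<Delta> powr (- 1 / 6)\<close> keeps the number of groups at least 1 up to phase 3, and the other one makes the
  surplus \<open>q * sqrt \<Delta>\<close> of colors in a group exceed the deviations, which are of order
  \<open>sqrt (y * sqrt \<Delta>)\<close>.
\<close>

definition survival :: "real \<Rightarrow> nat \<Rightarrow> real" where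
  "survival y \<Delta> = max (real \<Delta> powr (- 1 / 6)) (14 * sqrt (y / sqrt (real \<Delta>)))"

definition num_groups :: "real \<Rightarrow> nat \<Rightarrow> nat \<Rightarrow> nat" where
  "num_groups y \<Delta> j = (if j < 4 then nat \<lceil>survival y \<Delta> ^ j * sqrt (real \<Delta>)\<rceil> else 1)"

text \<open>Bounds for \<open>2 * d + 1\<close>, where \<open>d\<close> is a degree in a bin: early
  \<open>d\<close> is at most \<open>x + 2 * sqrt (y * x)\<close> with
  \<open>x = sqrt \<Delta>\<close>, and in the last phase \<open>d\<close> is at most three times
  the maximum, so that 7 = 2 * 3 + 1.\<close>

definition piece_bound :: "real \<Rightarrow> nat \<Rightarrow> nat \<Rightarrow> nat" where
  "piece_bound y \<Delta> j =
     (if j < 4 then nat \<lfloor>5 * sqrt (real \<Delta>)\<rfloor> else nat \<lfloor>7 * max (survival y \<Delta> ^ 4 * real \<Delta>) y\<rfloor>)"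

text \<open>Single bins control degrees and bin sizes; the survivor events control the free colors
  and the last group. Only linearly many events have to be watched.\<close>

definition bin_events :: "nat \<Rightarrow> (nat \<times> nat) set set" where
  "bin_events n = (\<lambda>p. {p}) ` ({..<4} \<times> {..<n}) \<union> (\<lambda>j. {p. j \<le> fst p}) ` {..4}"

text \<open>The bound on \<open>y ^ 4\<close> says that the second candidate for \<open>q\<close>
  satisfies \<open>(14 * sqrt (y / sqrt \<Delta>)) ^ 8 \<le> 1 / \<Delta>\<close>, which is what the
  size of the last group requires.\<close>

locale phase_params =
  fixes n \<Delta> :: nat and y :: real
  assumes y_ge_1: "1 \<le> y" and degree_large: "14 ^ 8 * y ^ 4 \<le> real \<Delta>"
    and degree_le: "\<Delta> \<le> n" and y_small: "y\<^sup>2 \<le> real n"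
begin

abbreviation "q \<equiv> survival y \<Delta>"
abbreviation "k \<equiv> num_groups y \<Delta>"
definition "x = sqrt (real \<Delta>)"

lemma x_sq: "x * x = real \<Delta>"
  by (simp add: x_def)

lemma x_large: "14 ^ 4 * y\<^sup>2 \<le> x"
proof -
  have "(14 ^ 4 * y\<^sup>2)\<^sup>2 \<le> real \<Delta>" using degree_large by (simp add: power_mult_distrib)
  then show ?thesis unfolding x_def by (rule real_le_rsqrt)
qed

lemma x_ge: "38416 * y \<le> x" "38416 \<le> x" "x > 0"
proof -
  have "y \<le> y\<^sup>2" using y_ge_1 by (simp add: power2_eq_square)
  then show "38416 * y \<le> x" using x_large by simp
  then show "38416 \<le> x" "x > 0" using y_ge_1 by auto
qed

lemma degree_pos: "real \<Delta> > 1"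
  using x_sq x_ge mult_mono[of 38416 x 38416 x] by simp

lemma x_le: "x \<le> real \<Delta>" "x * x \<le> real n" "x * y \<le> real n"
proof -
  show "x \<le> real \<Delta>" using x_sq x_ge mult_left_mono[of 1 x x] by simp
  show *: "x * x \<le> real n" using x_sq degree_le by simp
  have "x * y \<le> x * x" using x_ge y_ge_1 by (intro mult_left_mono) auto
  with * show "x * y \<le> real n" by simp
qed

text \<open>From \<open>14 ^ 4 * y \<le> x\<close>: the fluctuation \<open>sqrt (y * x)\<close> is
  at most \<open>x / 14 ^ 2\<close>, small beside means of order \<open>x\<close>.\<close>

lemma root_le: "196 * sqrt (y * x) \<le> x" "sqrt (y * x) > 0" "y \<le> sqrt (y * x)"
proof -
  have "(196 * sqrt (y * x))\<^sup>2 = 38416 * y * x"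
    using x_ge y_ge_1 by (simp add: power_mult_distrib)
  also have "\<dots> \<le> x * x" using x_ge by (intro mult_right_mono) auto
  finally have "(196 * sqrt (y * x))\<^sup>2 \<le> x\<^sup>2" by (simp add: power2_eq_square)
  then show "196 * sqrt (y * x) \<le> x" by (rule power2_le_imp_le) (use x_ge in auto)
  show "sqrt (y * x) > 0" using x_ge y_ge_1 by simp
  show "y \<le> sqrt (y * x)"
    using x_ge y_ge_1 by (intro real_le_rsqrt) (auto simp: power2_eq_square intro!: mult_left_mono)
qed

lemma q_pos: "0 < q"
  using degree_pos by (simp add: survival_def less_max_iff_disj)

lemma q_x: "14 * sqrt (y * x) \<le> q * x"
proof -
  have "14 * sqrt (y * x) = 14 * sqrt (y / x) * x"
  proof -
    have "sqrt (y * x) = sqrt (y / x * (x * x))" using x_ge by simp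
    also have "\<dots> = sqrt (y / x) * x" using x_ge by (subst real_sqrt_mult) auto
    finally show ?thesis by simp
  qed
  also have "\<dots> \<le> q * x"
    using x_ge by (intro mult_right_mono) (auto simp: survival_def x_def)
  finally show ?thesis .
qed

lemma q_less_1: "q < 1"
proof -
  have "real \<Delta> powr (- 1 / 6) < 1"
    using degree_pos by (simp add: powr_less_one)
  moreover have "14 * sqrt (y / x) < 1"
  proof -
    have "(14 * sqrt (y / x))\<^sup>2 < 1\<^sup>2"
      using x_ge y_ge_1 by (simp add: power_mult_distrib field_simps)
    then show ?thesis by (rule power2_less_imp_less) simp
  qed
  ultimately show ?thesis by (simp add: survival_def x_def)
qed

text \<open>The cube of \<open>\<Delta> powr (- 1 / 6)\<close> is exactly \<open>1 / x\<close>, and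
  3 is the last phase with a hashed group.\<close>

lemma q_power_x: "1 \<le> q ^ j * x" if "j < 4"
proof -
  have "real \<Delta> powr (- 1 / 6) \<le> q" by (simp add: survival_def)
  then have "(real \<Delta> powr (- 1 / 6)) ^ 3 \<le> q ^ 3" by (intro power_mono) auto
  also have "(real \<Delta> powr (- 1 / 6)) ^ 3 = 1 / x"
    using degree_pos by (simp add: powr_power powr_minus powr_half_sqrt[symmetric] x_def field_simps)
  also have "q ^ 3 \<le> q ^ j"
    using that q_pos q_less_1 by (intro power_decreasing) auto
  finally show ?thesis using x_ge by (simp add: field_simps)
qed

text \<open>Whichever candidate attains the maximum, the bound holds: the first gives
  \<open>\<Delta> powr (- 1 / 3)\<close>, the second
  \<open>14 ^ 8 * y ^ 4 / \<Delta>\<close>.\<close>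

lemma q_power_8: "q ^ 8 * real \<Delta> \<le> 1"
proof (cases "real \<Delta> powr (- 1 / 6) \<ge> 14 * sqrt (y / x)")
  case True
  then have "q ^ 8 * real \<Delta> = real \<Delta> powr (- 8 / 6) * real \<Delta> powr 1"
    using degree_pos by (simp add: survival_def x_def powr_power)
  also have "\<dots> = real \<Delta> powr (- 1 / 3)"
    by (subst powr_add[symmetric]) simp
  also have "\<dots> \<le> 1"
    using degree_pos powr_mono[of "- 1 / 3" 0 "real \<Delta>"] by simp
  finally show ?thesis .
next
  case False
  then have "q ^ 8 = 14 ^ 8 * sqrt (y / x) ^ 8"
    by (simp add: survival_def x_def power_mult_distrib)
  also have "sqrt (y / x) ^ 8 = (sqrt (y / x) ^ 2) ^ 4"
    by (simp only: power_mult[symmetric]) simp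
  also have "\<dots> = (y / x) ^ 4" using x_ge y_ge_1 by simp
  finally have "q ^ 8 * real \<Delta> = 14 ^ 8 * y ^ 4 / real \<Delta>"
    using x_ge by (simp add: x_sq[symmetric] power_divide field_simps eval_nat_numeral)
  also have "\<dots> \<le> 1" using degree_large degree_pos by simp
  finally show ?thesis .
qed

lemma q_power_4: "q ^ 4 * y \<le> 1"
proof -
  have "(q ^ 4 * x)\<^sup>2 = q ^ 8 * real \<Delta>"
    by (simp add: power_mult_distrib x_sq[symmetric] power2_eq_square power_add[symmetric])
  then have "(q ^ 4 * x)\<^sup>2 \<le> 1\<^sup>2" using q_power_8 by simp
  then have "q ^ 4 * x \<le> 1" by (rule power2_le_imp_le) simp
  moreover have "q ^ 4 * y \<le> q ^ 4 * x" using q_pos x_ge y_ge_1 by (intro mult_left_mono) auto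
  ultimately show ?thesis by simp
qed

text \<open>Up to constants this is the number of vertices of the last group times its degree. The
  maxima with \<open>y\<close> allow for means too small to be concentrated and lead to the cases
  \<open>q ^ 4 * y \<le> 1\<close> and \<open>y\<^sup>2 \<le> n\<close>.\<close>

lemma last_phase_size: "max (q ^ 4 * real n) y * max (q ^ 4 * real \<Delta>) y \<le> real n"
proof -
  have "q ^ 4 * real n * (q ^ 4 * real \<Delta>) = (q ^ 8 * real \<Delta>) * real n"
    by (simp add: power_add[symmetric])
  also have "\<dots> \<le> real n" using mult_right_mono[OF q_power_8, of "real n"] by simp
  finally have 1: "q ^ 4 * real n * (q ^ 4 * real \<Delta>) \<le> real n" .
  have 2: "q ^ 4 * real n * y \<le> real n"
    using mult_right_mono[OF q_power_4, of "real n"] by (simp add: mult_ac)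
  have "y * (q ^ 4 * real \<Delta>) \<le> real \<Delta>"
    using mult_right_mono[OF q_power_4, of "real \<Delta>"] by (simp add: mult_ac)
  then have 3: "y * (q ^ 4 * real \<Delta>) \<le> real n" using degree_le by simp
  show ?thesis
    using 1 2 3 y_small by (auto simp: max_def power2_eq_square)
qed

section \<open>Means and deviations within one group\<close>

lemma groups_bounds:
  assumes "j < 4"
  shows "q ^ j * x \<le> real (k j)" "real (k j) \<le> 2 * (q ^ j * x)" "1 \<le> real (k j)"
proof -
  have "real (k j) = of_int \<lceil>q ^ j * x\<rceil>"
    using assms q_power_x[OF assms] by (simp add: num_groups_def x_def)
  then show "q ^ j * x \<le> real (k j)" "real (k j) \<le> 2 * (q ^ j * x)"
    using q_power_x[OF assms] by linarith+
  then show "1 \<le> real (k j)" using q_power_x[OF assms] by linarith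
qed

lemma k_pos: "k j > 0"
proof (cases "j < 4")
  case True
  then show ?thesis using groups_bounds(3)[of j] by linarith
qed (simp add: num_groups_def)

lemma k_le: "k j \<le> n"
proof (cases "j < 4")
  case True
  have "q ^ j * x \<le> 1 * x"
    using q_pos q_less_1 x_ge by (intro mult_right_mono power_le_one) auto
  then have "q ^ j * x \<le> real n" using x_le degree_le by linarith
  then have "\<lceil>q ^ j * x\<rceil> \<le> int n" by (simp add: ceiling_le_iff)
  then show ?thesis using True by (simp add: num_groups_def x_def nat_le_iff)
next
  case False
  then show ?thesis using degree_pos degree_le by (auto simp: num_groups_def)
qed

text \<open>The share of one group if \<open>q ^ j * \<Delta>\<close> remaining colors or neighbors
  are split evenly. Rounding the number of groups up costs at most a factor 2.\<close>

definition "z j = q ^ j * real \<Delta> / real (k j)"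

lemma z_bounds:
  assumes "j < 4"
  shows "x / 2 \<le> z j" "z j \<le> x"
proof -
  note g = groups_bounds[OF assms]
  have k: "real (k j) > 0" using g(3) by linarith
  have "x * real (k j) \<le> x * (2 * (q ^ j * x))" using g x_ge by (intro mult_left_mono) auto
  also have "\<dots> = 2 * (q ^ j * real \<Delta>)" by (simp add: x_sq[symmetric])
  finally show "x / 2 \<le> z j" using k by (simp add: z_def field_simps)
  have "q ^ j * real \<Delta> = x * (q ^ j * x)" by (simp add: x_sq[symmetric])
  also have "\<dots> \<le> x * real (k j)" using g x_ge by (intro mult_left_mono) auto
  finally show "z j \<le> x" using k by (simp add: z_def field_simps)
qed

lemma not_deviates_le:
  assumes "\<not> deviates y B A S h" "measure_pmf.prob B A * real (card S) \<le> \<mu>" "y \<le> \<mu>"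
  shows "real (card {v \<in> S. h v \<in> A}) \<le> measure_pmf.prob B A * real (card S) + 2 * sqrt (y * \<mu>)"
proof -
  have "real (card {v \<in> S. h v \<in> A}) \<le> measure_pmf.prob B A * real (card S) +
      2 * sqrt (y * max (measure_pmf.prob B A * real (card S)) y)"
    using assms(1) unfolding deviates_def by linarith
  also have "sqrt (y * max (measure_pmf.prob B A * real (card S)) y) \<le> sqrt (y * \<mu>)"
    using assms y_ge_1 by (intro real_sqrt_le_mono mult_left_mono) auto
  finally show ?thesis by simp
qed

lemma not_deviates_le3:
  assumes "\<not> deviates y B A S h" "measure_pmf.prob B A * real (card S) \<le> \<mu>"
  shows "real (card {v \<in> S. h v \<in> A}) \<le> 3 * max \<mu> y"
proof -
  have "sqrt (y * max \<mu> y) \<le> max \<mu> y"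
    using y_ge_1 by (intro real_le_lsqrt) (auto simp: power2_eq_square intro!: mult_right_mono)
  moreover have "measure_pmf.prob B A * real (card S) \<le> max \<mu> y" using assms(2) by simp
  ultimately show ?thesis
    using not_deviates_le[OF assms(1), of "max \<mu> y"] max.cobounded2[of y \<mu>] by linarith
qed

text \<open>By completing the square,
  \<open>w - 2 * sqrt (y * w) = (sqrt w - sqrt y)\<^sup>2 - y\<close>. It is needed because the
  number of hashed colors is known only from below, while the deviation grows with it.\<close>

lemma root_diff_mono:
  assumes "y \<le> w0" "w0 \<le> w"
  shows "w0 - 2 * sqrt (y * w0) \<le> w - 2 * sqrt (y * w)"
proof -
  have sq: "a - 2 * sqrt (y * a) = (sqrt a - sqrt y)\<^sup>2 - y" if "y \<le> a" for a
    using that y_ge_1 by (simp add: power2_diff real_sqrt_mult)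
  have "(sqrt w0 - sqrt y)\<^sup>2 \<le> (sqrt w - sqrt y)\<^sup>2"
    using assms by (intro power_mono) auto
  then show ?thesis using assms by (simp add: sq)
qed

lemma early_degree:
  assumes j: "j < 4" "b < k j" and S: "card S \<le> \<Delta>"
    and dev: "\<not> deviates y (bin_pmf q k) {(j, b)} S \<beta>"
  shows "real (card {u \<in> S. \<beta> u \<in> {(j, b)}}) \<le> (1 - q) * z j + 2 * sqrt (y * x)"
proof -
  have "measure_pmf.prob (bin_pmf q k) {(j, b)} * real (card S) \<le> q ^ j * (1 - q) / real (k j) * real \<Delta>"
    unfolding prob_bin_pmf_bin[where k = k and j = j, OF q_pos q_less_1 j] using S q_pos q_less_1 by (intro mult_left_mono) auto
  then have p: "measure_pmf.prob (bin_pmf q k) {(j, b)} * real (card S) \<le> (1 - q) * z j"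
    by (simp add: z_def mult_ac)
  have "(1 - q) * z j \<le> 1 * x"
    using q_pos q_less_1 z_bounds[OF j(1)] x_ge by (intro mult_mono) auto
  then show ?thesis
    using not_deviates_le[OF dev, of x] p x_ge y_ge_1 by auto
qed

text \<open>Two losses of \<open>2 * sqrt (y * x)\<close>: one from the fluctuating number of free
  colors, after division by the number of groups, and one from hashing these colors to the
  groups.\<close>

lemma early_palette:
  assumes j: "j < 4" "b < k j"
    and F: "q ^ j * real \<Delta> - 2 * sqrt (y * (q ^ j * real \<Delta>)) \<le> real (card F)"
    and dev: "\<not> deviates y (pmf_of_set {..<k j}) {b} F h"
  shows "real (card {c \<in> F. h c \<in> {b}}) \<ge> z j - 4 * sqrt (y * x)"
proof -
  define w where "w = real (card F) / real (k j)"
  define w0 where "w0 = z j - 2 * sqrt (y * x)"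
  have k: "real (k j) \<ge> 1" using groups_bounds[OF j(1)] by simp
  have p: "measure_pmf.prob (pmf_of_set {..<k j}) {b} * real (card F) = w"
    using j by (subst measure_pmf_of_set) (auto simp: w_def lessThan_empty_iff)
  have "q ^ j * real \<Delta> = z j * real (k j)" using k by (simp add: z_def)
  also have "\<dots> \<le> x * real (k j)" using z_bounds[OF j(1)] by (intro mult_right_mono) auto
  also have "\<dots> \<le> x * (real (k j) * real (k j))"
    using k x_ge mult_left_mono[of 1 "real (k j)" "real (k j)"] by (intro mult_left_mono) auto
  finally have "y * (q ^ j * real \<Delta>) \<le> y * (x * (real (k j) * real (k j)))"
    using y_ge_1 by (intro mult_left_mono) auto
  then have "sqrt (y * (q ^ j * real \<Delta>)) \<le> sqrt (y * x) * real (k j)"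
    by (intro real_le_lsqrt) (use x_ge y_ge_1 in \<open>auto simp: power_mult_distrib power2_eq_square mult_ac\<close>)
  then have "q ^ j * real \<Delta> - 2 * (sqrt (y * x) * real (k j)) \<le> real (card F)"
    using F by linarith
  moreover have "w0 = (q ^ j * real \<Delta> - 2 * (sqrt (y * x) * real (k j))) / real (k j)"
    using k by (simp add: w0_def z_def diff_divide_distrib)
  ultimately have "w0 \<le> w" using k by (simp add: w_def divide_right_mono)
  have "y \<le> w0"
    using z_bounds[OF j(1)] root_le by (simp add: w0_def)
  have "sqrt (y * w0) \<le> sqrt (y * x)"
    using z_bounds[OF j(1)] root_le y_ge_1
    by (intro real_sqrt_le_mono mult_left_mono) (auto simp: w0_def)
  then have "z j - 4 * sqrt (y * x) \<le> w - 2 * sqrt (y * w)"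
    using root_diff_mono[OF \<open>y \<le> w0\<close> \<open>w0 \<le> w\<close>] unfolding w0_def by linarith
  moreover have "max w y = w" using \<open>w0 \<le> w\<close> \<open>y \<le> w0\<close> by simp
  ultimately show ?thesis
    using dev unfolding deviates_def p by simp
qed

text \<open>The origin of the 14: degree and palette lose 2 + 4 = 6 fluctuations, and since
  \<open>z j\<close> may be as small as \<open>x / 2\<close>, only half of the 14 in
  \<open>q_x\<close> is left, which is 7.\<close>

lemma early_slack:
  assumes "j < 4"
  shows "(1 - q) * z j + 2 * sqrt (y * x) < z j - 4 * sqrt (y * x)"
proof -
  have "q * (x / 2) \<le> q * z j" using z_bounds[OF assms] q_pos by (intro mult_left_mono) auto
  then have "7 * sqrt (y * x) \<le> q * z j" using q_x by simp
  moreover have "(1 - q) * z j = z j - q * z j" by (simp add: algebra_simps)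
  ultimately show ?thesis using root_le(2) by linarith
qed

text \<open>The lower tail for survivors bounds the neighbors already colored. A degree below
  \<Delta> does no harm, as the mean number of colored neighbors increases with the degree.\<close>

lemma card_surviving:
  assumes j: "j \<le> 4" and S: "card S \<le> \<Delta>" "finite S" and big: "y \<le> q ^ j * real \<Delta>"
    and dev: "\<not> deviates y (bin_pmf q k) {p. j \<le> fst p} S \<beta>"
  shows "real (card {u \<in> S. fst (\<beta> u) < j}) \<le>
     real \<Delta> - (q ^ j * real \<Delta> - 2 * sqrt (y * (q ^ j * real \<Delta>)))"
proof -
  have p: "measure_pmf.prob (bin_pmf q k) {p. j \<le> fst p} = q ^ j"
    by (rule prob_bin_pmf_phase[OF q_pos q_less_1 j])
  have qS: "q ^ j * real (card S) \<le> q ^ j * real \<Delta>"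
    using S q_pos by (intro mult_left_mono) auto
  have "sqrt (y * max (q ^ j * real (card S)) y) \<le> sqrt (y * (q ^ j * real \<Delta>))"
    using qS big y_ge_1 by (intro real_sqrt_le_mono mult_left_mono) auto
  then have "real (card {u \<in> S. \<beta> u \<in> {p. j \<le> fst p}}) \<ge>
      q ^ j * real (card S) - 2 * sqrt (y * (q ^ j * real \<Delta>))"
    using dev unfolding deviates_def p by linarith
  moreover have "card {u \<in> S. fst (\<beta> u) < j} + card {u \<in> S. \<beta> u \<in> {p. j \<le> fst p}} = card S"
    using S by (subst card_Un_disjoint[symmetric]) (auto intro!: arg_cong[where f = card])
  moreover have "(1 - q ^ j) * real (card S) \<le> (1 - q ^ j) * real \<Delta>"
    using S q_pos q_less_1 by (intro mult_left_mono) (auto simp: power_le_one)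
  ultimately show ?thesis by (simp add: algebra_simps)
qed

end

text \<open>This is what makes the set hashed in phase \<open>j\<close> independent of the seed of
  phase \<open>j\<close>.\<close>

lemma phase_col_cong:
  "(\<And>i. i < j \<Longrightarrow> \<gamma> i = \<gamma>' i) \<Longrightarrow> phase_col n \<beta> \<gamma> N \<Psi> j = phase_col n \<beta> \<gamma>' N \<Psi> j"
proof (induction j)
  case (Suc j)
  then have eq: "phase_col n \<beta> \<gamma> N \<Psi> j = phase_col n \<beta> \<gamma>' N \<Psi> j" "\<gamma> j = \<gamma>' j" by simp_all
  have "short_palette \<beta> \<gamma> N \<Psi> f j = short_palette \<beta> \<gamma>' N \<Psi> f j" for f
    by (intro ext) (simp add: short_palette_def bin_palette_def eq(2))
  then show ?case unfolding phase_col.simps eq(1) by (rule arg_cong)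
qed simp

section \<open>Small deviations imply a good binning\<close>

context phase_params
begin

text \<open>The deterministic half of the analysis. The bins are tested on neighborhoods and on the
  whole vertex set; the color hash of a phase is tested on the colors that the run has left to a
  vertex.\<close>

lemma good_binning:
  assumes inst: "list_coloring_instance {..<n} E \<Psi>" and deg: "max_degree {..<n} E = \<Delta>"
    and supp: "\<And>v. v < n \<Longrightarrow> \<beta> v \<in> set_pmf (bin_pmf q k)"
    and dev_nbrs: "\<And>v A. v < n \<Longrightarrow> A \<in> bin_events n \<Longrightarrow> \<not> deviates y (bin_pmf q k) A (neighbors E v) \<beta>"
    and dev_all: "\<And>A. A \<in> bin_events n \<Longrightarrow> \<not> deviates y (bin_pmf q k) A {..<n} \<beta>"
    and dev_colors: "\<And>v j. v < n \<Longrightarrow> fst (\<beta> v) = j \<Longrightarrow> j < 4 \<Longrightarrow>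
      \<not> deviates y (pmf_of_set {..<k j}) {snd (\<beta> v)}
          (free_colors \<beta> (neighbors E) \<Psi> (phase_col n \<beta> \<gamma> (neighbors E) \<Psi> j) j v) (\<gamma> j)"
    and last: "\<gamma> 4 = (\<lambda>_. 0)"
  shows "binned_coloring n 5 E \<Psi> \<beta> \<gamma>"
    and "v < n \<Longrightarrow> snd (\<beta> v) < n"
    and "v < n \<Longrightarrow> 2 * card (bin_nbrs \<beta> (neighbors E) v) + 1 \<le> piece_bound y \<Delta> (fst (\<beta> v))"
    and "j < 5 \<Longrightarrow> card (bin_class n \<beta> (j, i)) * piece_bound y \<Delta> j \<le> 21 * n"
proof -
  let ?N = "neighbors E"
  have graph: "simple_graph {..<n} E" and list: "\<And>v. v < n \<Longrightarrow> card (\<Psi> v) = \<Delta> + 1"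
    using inst deg by (auto simp: list_coloring_instance_def)
  have finite_list: "finite (\<Psi> v)" if "v < n" for v
    using list[OF that] by (intro card_ge_0_finite) simp
  note N = max_degree_bounds[OF graph, unfolded deg]
  have \<beta>: "fst (\<beta> v) \<le> 4" "snd (\<beta> v) < k (fst (\<beta> v))" if "v < n" for v
    using set_bin_pmf[OF k_pos supp[OF that]] by auto
  show \<beta>_less: "snd (\<beta> v) < n" if "v < n" for v
    using \<beta>(2)[OF that] k_le[of "fst (\<beta> v)"] by simp
  have single: "{(j, b)} \<in> bin_events n" if "j < 4" "b < n" for j b
    using that by (auto simp: bin_events_def)
  have phase: "{p. j \<le> fst p} \<in> bin_events n" if "j \<le> 4" for j
    using that by (auto simp: bin_events_def)

  have nbrs_early: "real (card (bin_nbrs \<beta> ?N v)) \<le> (1 - q) * z j + 2 * sqrt (y * x)"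
    if v: "v < n" and j: "fst (\<beta> v) = j" "j < 4" for v j
  proof -
    have "bin_nbrs \<beta> ?N v = {u \<in> ?N v. \<beta> u \<in> {(j, snd (\<beta> v))}}"
      using j by (auto simp: bin_nbrs_def prod_eq_iff)
    then show ?thesis
      using early_degree[OF j(2) _ N(3)[OF v] dev_nbrs[OF v single[OF j(2) \<beta>_less[OF v]]]] \<beta>(2)[OF v] j
      by simp
  qed
  have nbrs_last: "real (card (bin_nbrs \<beta> ?N v)) \<le> 3 * max (q ^ 4 * real \<Delta>) y"
    if v: "v < n" and j: "fst (\<beta> v) = 4" for v
  proof -
    have "real (card (bin_nbrs \<beta> ?N v)) \<le> real (card {u \<in> ?N v. \<beta> u \<in> {p. 4 \<le> fst p}})"
      using N(1)[OF v] j by (intro of_nat_mono card_mono) (auto simp: bin_nbrs_def)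
    also have "\<dots> \<le> 3 * max (q ^ 4 * real \<Delta>) y"
    proof (rule not_deviates_le3[OF dev_nbrs[OF v phase[OF order_refl]]])
      show "measure_pmf.prob (bin_pmf q k) {p. 4 \<le> fst p} * real (card (?N v)) \<le> q ^ 4 * real \<Delta>"
        unfolding prob_bin_pmf_phase[OF q_pos q_less_1 order_refl]
        using N(3)[OF v] q_pos by (intro mult_left_mono) auto
    qed
    finally show ?thesis .
  qed

  show "binned_coloring n 5 E \<Psi> \<beta> \<gamma>"
  proof
    show "simple_graph {..<n} E" by (rule graph)
    show "finite (\<Psi> v)" if "v < n" for v by (rule finite_list[OF that])
    show "fst (\<beta> v) < 5" if "v < n" for v using \<beta>(1)[OF that] by simp
    fix v assume v: "v < n"
    define j where "j = fst (\<beta> v)"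
    define f where "f = phase_col n \<beta> \<gamma> ?N \<Psi> j"
    have "card (bin_nbrs \<beta> ?N v) < card (bin_palette \<beta> \<gamma> ?N \<Psi> f j v)"
    proof (cases "j = 4")
      case True
      have "snd (\<beta> v) = 0" using \<beta>(2)[OF v] True by (simp add: j_def num_groups_def)
      then show ?thesis
        using N(3)[OF v] list[OF v] last True
        by (intro last_phase_slack[where N = "?N" and \<Psi> = \<Psi>] N(1) finite_list v) (auto simp: j_def)
    next
      case False
      then have j: "j < 4" using \<beta>(1)[OF v] by (simp add: j_def)
      define F where "F = free_colors \<beta> ?N \<Psi> f j v"
      have "y \<le> q ^ j * real \<Delta>"
      proof -
        \<comment> \<open>\<open>q ^ j * \<Delta>\<close> is \<open>q ^ j * x\<close> times
          \<open>x\<close>, with first factor at least 1.\<close>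
        have "1 * x \<le> q ^ j * x * x" using q_power_x[OF j] x_ge by (intro mult_right_mono) auto
        then show ?thesis using x_ge y_ge_1 by (simp add: mult.assoc x_sq)
      qed
      then have "real (card {u \<in> ?N v. fst (\<beta> u) < j}) \<le>
          real \<Delta> - (q ^ j * real \<Delta> - 2 * sqrt (y * (q ^ j * real \<Delta>)))"
        using j by (intro card_surviving N v dev_nbrs phase) auto
      moreover have "real \<Delta> + 1 \<le> real (card F) + real (card {u \<in> ?N v. fst (\<beta> u) < j})"
        using card_free_colors[where N = "?N" and \<Psi> = \<Psi> and v = v, OF N(1) finite_list, OF v v, of \<beta> f j] list[OF v]
        unfolding F_def by linarith
      ultimately have "q ^ j * real \<Delta> - 2 * sqrt (y * (q ^ j * real \<Delta>)) \<le> real (card F)" by linarith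
      then have "z j - 4 * sqrt (y * x) \<le> real (card {c \<in> F. \<gamma> j c \<in> {snd (\<beta> v)}})"
        using dev_colors[OF v j_def[symmetric] j] \<beta>(2)[OF v] unfolding F_def f_def j_def[symmetric]
        by (intro early_palette j)
      also have "{c \<in> F. \<gamma> j c \<in> {snd (\<beta> v)}} = bin_palette \<beta> \<gamma> ?N \<Psi> f j v"
        by (auto simp: F_def bin_palette_def)
      finally show ?thesis
        using nbrs_early[OF v j_def[symmetric] j] early_slack[OF j] by linarith
    qed
    then show "card (bin_nbrs \<beta> ?N v) < card (bin_palette \<beta> \<gamma> ?N \<Psi>
        (phase_col n \<beta> \<gamma> ?N \<Psi> (fst (\<beta> v))) (fst (\<beta> v)) v)"
      unfolding f_def j_def .
  qed

  show "2 * card (bin_nbrs \<beta> ?N v) + 1 \<le> piece_bound y \<Delta> (fst (\<beta> v))" if v: "v < n" for v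
  proof (cases "fst (\<beta> v) < 4")
    case True
    define j where "j = fst (\<beta> v)"
    have "(1 - q) * z j \<le> 1 * x"
      using q_pos q_less_1 z_bounds[of j] True x_ge by (intro mult_mono) (auto simp: j_def)
    then have "2 * real (card (bin_nbrs \<beta> ?N v)) + 1 \<le> 5 * x"
      using nbrs_early[OF v j_def[symmetric]] True root_le x_ge unfolding j_def[symmetric] by linarith
    then have "real (2 * card (bin_nbrs \<beta> ?N v) + 1) \<le> 5 * sqrt (real \<Delta>)" by (simp add: x_def)
    then show ?thesis
      using True unfolding piece_bound_def by (simp add: le_nat_floor del: of_nat_add of_nat_mult)
  next
    case False
    then have "fst (\<beta> v) = 4" using \<beta>(1)[OF v] by simp
    moreover have "1 \<le> max (q ^ 4 * real \<Delta>) y" using y_ge_1 by simp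
    ultimately have "real (2 * card (bin_nbrs \<beta> ?N v) + 1) \<le> 7 * max (q ^ 4 * real \<Delta>) y"
      using nbrs_last[OF v] by simp
    then show ?thesis
      using False unfolding piece_bound_def by (simp add: le_nat_floor del: of_nat_add of_nat_mult)
  qed

  show "card (bin_class n \<beta> (j, i)) * piece_bound y \<Delta> j \<le> 21 * n" if j: "j < 5" for j i
  proof (cases "bin_class n \<beta> (j, i) = {}")
    case False
    then obtain v where v: "v < n" "\<beta> v = (j, i)" by (auto simp: bin_class_def)
    have i: "i < k j" "i < n" using \<beta>(2)[OF v(1)] \<beta>_less[OF v(1)] v by auto
    have "real (card (bin_class n \<beta> (j, i))) * real (piece_bound y \<Delta> j) \<le> 21 * real n"
    proof (cases "j < 4")
      case True
      have "real (piece_bound y \<Delta> j) \<le> 5 * x"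
        using True x_ge by (simp add: piece_bound_def x_def)
      moreover have "real (card (bin_class n \<beta> (j, i))) \<le> 3 * (real n / x)"
      proof -
        have "q ^ j * x * (1 - q) \<le> real (k j) * 1"
          using groups_bounds(1)[OF True] q_pos q_less_1 x_ge by (intro mult_mono) auto
        then have "measure_pmf.prob (bin_pmf q k) {(j, i)} \<le> 1 / x"
          unfolding prob_bin_pmf_bin[where k = k and j = j, OF q_pos q_less_1 True i(1)]
          using k_pos[of j] x_ge by (simp add: field_simps)
        then have "measure_pmf.prob (bin_pmf q k) {(j, i)} * real (card {..<n}) \<le> 1 / x * real n"
          by (intro mult_mono) (use x_ge in auto)
        then have "real (card {u \<in> {..<n}. \<beta> u \<in> {(j, i)}}) \<le> 3 * max (real n / x) y"
          by (intro not_deviates_le3[OF dev_all[OF single[OF True i(2)]]]) simp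
        \<comment> \<open>The mean size of a group is allowed to be \<open>n / x\<close>, which
          dominates \<open>y\<close> because \<open>x * y \<le> n\<close>.\<close>
        moreover have "y \<le> real n / x" using x_le x_ge by (simp add: field_simps)
        ultimately show ?thesis by (simp add: bin_class_def max_def)
      qed
      ultimately have "real (card (bin_class n \<beta> (j, i))) * real (piece_bound y \<Delta> j) \<le>
          3 * (real n / x) * (5 * x)"
        using x_ge by (intro mult_mono) auto
      also have "\<dots> \<le> 21 * real n" using x_ge by simp
      finally show ?thesis .
    next
      case False
      then have [simp]: "j = 4" using j by simp
      have "real (piece_bound y \<Delta> j) \<le> 7 * max (q ^ 4 * real \<Delta>) y"
        using y_ge_1 by (simp add: piece_bound_def)
      moreover have "real (card (bin_class n \<beta> (j, i))) \<le> 3 * max (q ^ 4 * real n) y"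
      proof -
        have "real (card (bin_class n \<beta> (j, i))) \<le> real (card {u \<in> {..<n}. \<beta> u \<in> {p. 4 \<le> fst p}})"
          by (intro of_nat_mono card_mono) (auto simp: bin_class_def)
        also have "\<dots> \<le> 3 * max (q ^ 4 * real n) y"
          by (rule not_deviates_le3[OF dev_all[OF phase[OF order_refl]]])
            (simp add: prob_bin_pmf_phase[OF q_pos q_less_1 order_refl])
        finally show ?thesis .
      qed
      ultimately have "real (card (bin_class n \<beta> (j, i))) * real (piece_bound y \<Delta> j) \<le>
          3 * max (q ^ 4 * real n) y * (7 * max (q ^ 4 * real \<Delta>) y)"
        using y_ge_1 by (intro mult_mono) auto
      \<comment> \<open>The constant 21 is 3 * 7 from the last phase; the early phases need only 3 *
        5.\<close>
      also have "\<dots> \<le> 21 * real n" using last_phase_size by simp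
      finally show ?thesis .
    qed
    then have "real (card (bin_class n \<beta> (j, i)) * piece_bound y \<Delta> j) \<le> real (21 * n)" by simp
    then show ?thesis by (simp only: of_nat_le_iff)
  qed simp
qed

end

section \<open>Choice of the seeds and the main theorem\<close>

lemma card_bin_events: "finite (bin_events n)" "card (bin_events n) \<le> 4 * n + 5"
proof -
  show "finite (bin_events n)" by (simp add: bin_events_def)
  have "card (bin_events n) \<le> card ((\<lambda>p. {p}) ` ({..<4 :: nat} \<times> {..<n})) + card ((\<lambda>j. {p. j \<le> fst p}) ` {..4} :: (nat \<times> nat) set set)"
    unfolding bin_events_def by (rule card_Un_le)
  also have "\<dots> \<le> card ({..<4 :: nat} \<times> {..<n}) + card {..4 :: nat}"
    by (intro add_mono card_image_le) auto
  finally show "card (bin_events n) \<le> 4 * n + 5" by (simp add: card_cartesian_product)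
qed

lemma prob_Bex_le:
  assumes "finite S" "\<And>s. s \<in> S \<Longrightarrow> measure_pmf.prob M {x. P s x} \<le> \<delta>"
  shows "measure_pmf.prob M {x. \<exists>s\<in>S. P s x} \<le> real (card S) * \<delta>"
proof -
  have "measure_pmf.prob M (\<Union>s\<in>S. {x. P s x}) \<le> (\<Sum>s\<in>S. measure_pmf.prob M {x. P s x})"
    by (rule measure_pmf.finite_measure_subadditive_finite[OF assms(1)]) auto
  also have "\<dots> \<le> real (card S) * \<delta>"
    by (rule sum_bounded_above[OF assms(2)])
  finally show ?thesis by (simp add: Collect_bex_eq)
qed

lemma AE_coin_flips:
  "AE \<omega> in measure_pmf (coin_flips n m). (\<forall>v<n. length (\<omega> v) = m) \<and> (\<forall>v\<ge>n. \<omega> v = [])"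
proof -
  have "finite {bs :: bool list. set bs \<subseteq> UNIV \<and> length bs = m}" by (rule finite_lists_length_eq) simp
  then have "finite {bs :: bool list. length bs = m}" by simp
  moreover have "replicate m True \<in> {bs :: bool list. length bs = m}" by simp
  then have "{bs :: bool list. length bs = m} \<noteq> {}" by blast
  ultimately show ?thesis
    unfolding AE_measure_pmf_iff coin_flips_def
    by (auto simp: set_Pi_pmf PiE_dflt_def set_pmf_of_set not_less)
qed

text \<open>The first bound on \<open>m\<close> is the requirement of \<open>hash_family\<close>,
  the second makes a seed fail with probability small enough for a union bound over about
  \<open>5 * n\<close> tested sets.\<close>

lemma seeds_large:
  fixes n D d K k m :: nat and y :: real
  assumes n: "n \<ge> 6" and y: "1 \<le> y" "14 ^ 8 * y ^ 4 \<le> real D" "y\<^sup>2 \<le> real n"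
    and m: "2 ^ m * (36 * real n * exp (- y)) \<le> 1" "6 * n ^ (d + 1) * max n (2 ^ K) \<le> 2 ^ m" and k: "K \<le> k"
  shows "\<exists>B C s. \<forall>E \<Psi>. list_coloring_instance {..<n} E \<Psi> \<and> (\<forall>v<n. \<Psi> v \<subseteq> {..<2 ^ K}) \<and>
     max_degree {..<n} E \<ge> D \<longrightarrow>
     measure_pmf.prob (coin_flips n m) {\<omega>. (E, \<Psi>, \<omega>) \<in> good_worlds n 5 m k 21 B C s} \<ge> 1 - 1 / real n ^ d"
proof -
  define \<delta> where "\<delta> = real (max n (2 ^ K)) / 2 ^ m"
  have y_pos: "0 < y" using y by simp
  \<comment> \<open>At most \<open>9 * n\<close> events are watched: \<open>4 * n + 5\<close> for
    bins and at most \<open>n\<close> for groups of colors. Thus 36 = 4 * 9.\<close>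
  have exp_le: "2 ^ m * (4 * real a * exp (- y)) \<le> 1" if "a \<le> 9 * n" for a
  proof -
    have "2 ^ m * (4 * real a * exp (- y)) \<le> 2 ^ m * (36 * real n * exp (- y))"
      using that by (intro mult_left_mono mult_right_mono) auto
    then show ?thesis using m(1) by linarith
  qed
  define good_B where "good_B \<Delta> H \<longleftrightarrow> (\<forall>bs x. length bs = m \<longrightarrow> x < n \<longrightarrow> H bs x \<in> set_pmf (bin_pmf (survival y \<Delta>) (num_groups y \<Delta>))) \<and>
     (\<forall>S. S \<subseteq> {..<n} \<longrightarrow> measure_pmf.prob (pmf_of_set {bs. length bs = m})
        {bs. \<exists>A\<in>bin_events n. deviates y (bin_pmf (survival y \<Delta>) (num_groups y \<Delta>)) A S (H bs)} \<le> \<delta>)"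
    for \<Delta> and H :: "bool list \<Rightarrow> nat \<Rightarrow> nat \<times> nat"
  have "\<exists>H. good_B \<Delta> H" for \<Delta>
  proof -
    have events: "card (bin_events n) \<le> 9 * n" using card_bin_events(2)[of n] n by simp
    note hash_family[OF finite_lessThan[of n] card_bin_events(1)[of n] y_pos exp_le[OF events],
        of "bin_pmf (survival y \<Delta>) (num_groups y \<Delta>)"]
    moreover have "real (card {..<n}) / 2 ^ m \<le> \<delta>" by (simp add: \<delta>_def divide_right_mono)
    ultimately show ?thesis unfolding good_B_def by (elim ex_forward) (auto intro: order.trans)
  qed
  then obtain B where "\<And>\<Delta>. good_B \<Delta> (B \<Delta>)" by metis
  then have B_supp: "\<And>\<Delta> bs x. length bs = m \<Longrightarrow> x < n \<Longrightarrow>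
      B \<Delta> bs x \<in> set_pmf (bin_pmf (survival y \<Delta>) (num_groups y \<Delta>))"
    and B_dev: "\<And>\<Delta> S. S \<subseteq> {..<n} \<Longrightarrow> measure_pmf.prob (pmf_of_set {bs. length bs = m})
        {bs. \<exists>A\<in>bin_events n. deviates y (bin_pmf (survival y \<Delta>) (num_groups y \<Delta>)) A S (B \<Delta> bs)} \<le> \<delta>"
    unfolding good_B_def by blast+
  define good_C where "good_C \<Delta> j H \<longleftrightarrow> (\<forall>S. S \<subseteq> {..<2 ^ K} \<longrightarrow> measure_pmf.prob (pmf_of_set {bs. length bs = m})
        {bs. \<exists>b\<in>{..<n}. deviates y (pmf_of_set {..<num_groups y \<Delta> j}) {b} S (H bs)} \<le> \<delta>)"
    for \<Delta> j and H :: "bool list \<Rightarrow> nat \<Rightarrow> nat"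
  have "\<exists>H. good_C \<Delta> j H" for \<Delta> j
  proof -
    have image: "(\<exists>A\<in>(\<lambda>b. {b}) ` {..<n}. Q A) \<longleftrightarrow> (\<exists>b\<in>{..<n}. Q {b})" for Q :: "nat set \<Rightarrow> bool"
      by blast
    have "card ((\<lambda>b. {b}) ` {..<n}) \<le> 9 * n"
      using card_image_le[of "{..<n}" "\<lambda>b. {b}"] by simp
    from hash_family[OF finite_lessThan[of "2 ^ K :: nat"] finite_imageI[OF finite_lessThan] y_pos exp_le[OF this],
        of "pmf_of_set {..<num_groups y \<Delta> j}"]
    have "\<exists>H :: bool list \<Rightarrow> nat \<Rightarrow> nat. \<forall>S\<subseteq>{..<2 ^ K}. measure_pmf.prob (pmf_of_set {bs. length bs = m})
        {bs. \<exists>b\<in>{..<n}. deviates y (pmf_of_set {..<num_groups y \<Delta> j}) {b} S (H bs)} \<le> real (card {..<2 ^ K :: nat}) / 2 ^ m"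
      unfolding image by (rule ex_forward) (erule conjunct2)
    moreover have "real (card {..<2 ^ K :: nat}) / 2 ^ m \<le> \<delta>"
      unfolding \<delta>_def by (intro divide_right_mono of_nat_mono) auto
    ultimately show ?thesis unfolding good_C_def by (elim ex_forward) (auto intro: order.trans)
  qed
  then obtain C where "\<And>\<Delta> j. good_C \<Delta> j (C \<Delta> j)" by metis
  then have C_dev: "S \<subseteq> {..<2 ^ K} \<Longrightarrow> measure_pmf.prob (pmf_of_set {bs. length bs = m})
        {bs. \<exists>b\<in>{..<n}. deviates y (pmf_of_set {..<num_groups y \<Delta> j}) {b} S (C \<Delta> j bs)} \<le> \<delta>" for \<Delta> j S
    unfolding good_C_def by blast
  define C' where "C' \<Delta> j = (if j < 4 then C \<Delta> j else (\<lambda>bs c. 0 :: nat))" for \<Delta> j :: nat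
  show ?thesis
  proof (rule exI[of _ B], rule exI[of _ C'], rule exI[of _ "piece_bound y"], intro allI impI, elim conjE)
    fix E and \<Psi> :: "nat \<Rightarrow> nat set"
    assume inst: "list_coloring_instance {..<n} E \<Psi>" and colors: "\<forall>v<n. \<Psi> v \<subseteq> {..<2 ^ K}"
      and D: "D \<le> max_degree {..<n} E"
    define \<Delta> where "\<Delta> = max_degree {..<n} E"
    have graph: "simple_graph {..<n} E" using inst by (simp add: list_coloring_instance_def)
    have N: "neighbors E v \<subseteq> {..<n}" "\<Delta> \<le> n" if "v < n" for v
      using max_degree_bounds[OF graph that] by (auto simp: \<Delta>_def)
    interpret phase_params n \<Delta> y
      by unfold_locales (use y D N(2)[of 0] n in \<open>auto simp: \<Delta>_def\<close>)
    define \<beta> where "\<beta> \<omega> = B \<Delta> (\<omega> 0)" for \<omega> :: "nat \<Rightarrow> bool list"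
    define \<gamma> where "\<gamma> \<omega> j = C' \<Delta> j (\<omega> (Suc j))" for \<omega> :: "nat \<Rightarrow> bool list" and j
    define free where "free \<omega> j v = free_colors (\<beta> \<omega>) (neighbors E) \<Psi>
        (phase_col n (\<beta> \<omega>) (\<gamma> \<omega>) (neighbors E) \<Psi> j) j v" for \<omega> j v
    define F where "F = {\<omega>. \<exists>S\<in>insert {..<n} (neighbors E ` {..<n}).
        \<exists>A\<in>bin_events n. deviates y (bin_pmf q (num_groups y \<Delta>)) A S (\<beta> \<omega>)}"
    define G where "G j = {\<omega>. \<exists>v\<in>{..<n}. \<exists>b\<in>{..<n}.
        deviates y (pmf_of_set {..<num_groups y \<Delta> j}) {b} (free \<omega> j v) (\<gamma> \<omega> j)}" for j
    have "\<delta> \<ge> 0" by (simp add: \<delta>_def)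
    have "measure_pmf.prob (coin_flips n m) F \<le> real (n + 1) * \<delta>"
    proof (rule prob_coin_flips_le[of 0])
      fix f
      let ?S = "insert {..<n} (neighbors E ` {..<n})"
      have "measure_pmf.prob (pmf_of_set {bs. length bs = m}) {bs. f(0 := bs) \<in> F} \<le> real (card ?S) * \<delta>"
        unfolding F_def \<beta>_def mem_Collect_eq fun_upd_same
        using N(1) by (intro prob_Bex_le) (auto intro!: B_dev)
      also have "\<dots> \<le> real (n + 1) * \<delta>"
      proof (intro mult_right_mono of_nat_mono)
        have "card ?S \<le> Suc (card (neighbors E ` {..<n}))" by (rule card_insert_le_m1) auto
        also have "\<dots> \<le> n + 1" using card_image_le[of "{..<n}" "neighbors E"] by simp
        finally show "card ?S \<le> n + 1" .
      qed (rule \<open>\<delta> \<ge> 0\<close>)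
      finally show "measure_pmf.prob (pmf_of_set {bs. length bs = m}) {bs. f(0 := bs) \<in> F} \<le> real (n + 1) * \<delta>" .
    qed (use n in simp)
    moreover have "measure_pmf.prob (coin_flips n m) (G j) \<le> real n * \<delta>" if j: "j < 4" for j
    proof (rule prob_coin_flips_le[of "Suc j"])
      fix f
      \<comment> \<open>Bins use the coins of processor 0, and the coloring before phase
        \<open>j\<close> uses the hashes of phases \<open>i < j\<close>, that is, the coins of
        processors \<open>Suc i \<le> j\<close>.\<close>
      have "free (f(Suc j := bs)) j = free f j" for bs
        unfolding free_def[abs_def] \<beta>_def
        by (subst phase_col_cong[where \<gamma>' = "\<gamma> f"]) (auto simp: \<gamma>_def)
      then have "{bs. f(Suc j := bs) \<in> G j} = {bs. \<exists>v\<in>{..<n}. \<exists>b\<in>{..<n}.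
          deviates y (pmf_of_set {..<num_groups y \<Delta> j}) {b} (free f j v) (C \<Delta> j bs)}"
        using j by (simp add: G_def \<gamma>_def C'_def)
      also have "measure_pmf.prob (pmf_of_set {bs. length bs = m}) \<dots> \<le> real (card {..<n}) * \<delta>"
        using colors by (intro prob_Bex_le C_dev) (auto simp: free_def free_colors_def)
      finally show "measure_pmf.prob (pmf_of_set {bs. length bs = m}) {bs. f(Suc j := bs) \<in> G j} \<le> real n * \<delta>"
        by simp
    qed (use n j in simp)
    then have "measure_pmf.prob (coin_flips n m) (\<Union>j\<in>{..<4}. G j) \<le> (\<Sum>j\<in>{..<4 :: nat}. real n * \<delta>)"
      by (intro order.trans[OF measure_pmf.finite_measure_subadditive_finite] sum_mono) auto
    ultimately have "measure_pmf.prob (coin_flips n m) (F \<union> (\<Union>j\<in>{..<4}. G j)) \<le>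
        real (n + 1) * \<delta> + 4 * (real n * \<delta>)"
      by (intro order.trans[OF measure_Un_le] add_mono) auto
    \<comment> \<open>\<open>n + 1\<close> sets are tested for the bins and \<open>n\<close> sets in
      each of four phases for the colors.\<close>
    also have "\<dots> = (5 * real n + 1) * \<delta>" by (simp add: algebra_simps)
    also have "\<dots> \<le> 6 * real n * \<delta>" using n \<open>\<delta> \<ge> 0\<close> by (intro mult_right_mono) auto
    also have "\<dots> \<le> 1 / real n ^ d"
    proof -
      have "real (6 * n ^ (d + 1) * max n (2 ^ K)) \<le> real (2 ^ m)"
        using m(2) by (rule of_nat_mono)
      then have "6 * real n * real (max n (2 ^ K)) * real n ^ d \<le> 2 ^ m"
        by (simp only: of_nat_mult of_nat_power of_nat_numeral power_add power_one_right mult_ac)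
      then show ?thesis using n by (simp add: \<delta>_def field_simps)
    qed
    finally have bad: "measure_pmf.prob (coin_flips n m) (F \<union> (\<Union>j\<in>{..<4}. G j)) \<le> 1 / real n ^ d" .
    let ?W = "{\<omega>. (E, \<Psi>, \<omega>) \<in> good_worlds n 5 m k 21 B C' (piece_bound y)}"
    have good: "\<omega> \<in> ?W" if \<omega>: "\<forall>v<n. length (\<omega> v) = m" "\<forall>v\<ge>n. \<omega> v = []" and "\<omega> \<notin> F \<union> (\<Union>j\<in>{..<4}. G j)" for \<omega>
    proof -
      have supp: "\<beta> \<omega> v \<in> set_pmf (bin_pmf q (num_groups y \<Delta>))" if "v < n" for v
        unfolding \<beta>_def using B_supp \<omega>(1) that by simp
      have "snd (\<beta> \<omega> v) < n" if "v < n" for v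
        using set_bin_pmf(2)[OF k_pos supp[OF that]] k_le order.strict_trans2 by blast
      then have *: "\<not> deviates y (pmf_of_set {..<num_groups y \<Delta> j}) {snd (\<beta> \<omega> v)} (free \<omega> j v) (\<gamma> \<omega> j)"
        if "v < n" "j < 4" for v j
        using \<open>\<omega> \<notin> _\<close> that by (auto simp: G_def)
      have "list_coloring_instance {..<n} E \<Psi>" "max_degree {..<n} E = \<Delta>"
        "\<And>v A. v < n \<Longrightarrow> A \<in> bin_events n \<Longrightarrow> \<not> deviates y (bin_pmf q (num_groups y \<Delta>)) A (neighbors E v) (\<beta> \<omega>)"
        "\<And>A. A \<in> bin_events n \<Longrightarrow> \<not> deviates y (bin_pmf q (num_groups y \<Delta>)) A {..<n} (\<beta> \<omega>)"
        "\<gamma> \<omega> 4 = (\<lambda>_. 0)"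
        using \<open>\<omega> \<notin> _\<close> inst by (auto simp: F_def \<Delta>_def \<gamma>_def C'_def)
      note good = good_binning[OF this(1,2) supp this(3,4) *[unfolded free_def] this(5)]
      have "\<forall>v<n. \<Psi> v \<subseteq> {..<2 ^ k}"
        using colors k by (meson lessThan_subset_iff order.trans one_le_numeral power_increasing)
      then show ?thesis
        using \<omega> inst good unfolding good_worlds_def mem_Collect_eq prod.case Let_def \<Delta>_def[symmetric]
          \<beta>_def[symmetric] \<gamma>_def[symmetric, abs_def]
        by auto
    qed
    have "measure_pmf.prob (coin_flips n m) (- ?W) \<le> measure_pmf.prob (coin_flips n m) (F \<union> (\<Union>j\<in>{..<4}. G j))"
      by (rule measure_pmf.finite_measure_mono_AE, rule eventually_mono[OF AE_coin_flips[of n m]])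
        (use good in \<open>blast, simp\<close>)
    moreover have "measure_pmf.prob (coin_flips n m) (- ?W) = 1 - measure_pmf.prob (coin_flips n m) ?W"
      using measure_pmf.prob_compl[of ?W "coin_flips n m"] by (simp add: Compl_eq_Diff_UNIV)
    ultimately show "1 - 1 / real n ^ d \<le> measure_pmf.prob (coin_flips n m) ?W"
      using bad by linarith
  qed
qed

text \<open>For the finitely many \<open>n\<close> where the parameters do not fit: all vertices
  form the last group, and \<open>2 * n + 1\<close> batches suffice to collect the whole
  graph.\<close>

lemma seeds_small:
  fixes n D d K k m :: nat
  assumes n: "n \<ge> 1" and k: "K \<le> k"
  shows "\<exists>B C s. \<forall>E \<Psi>. list_coloring_instance {..<n} E \<Psi> \<and> (\<forall>v<n. \<Psi> v \<subseteq> {..<2 ^ K}) \<and>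
     max_degree {..<n} E \<ge> D \<longrightarrow>
     measure_pmf.prob (coin_flips n m) {\<omega>. (E, \<Psi>, \<omega>) \<in> good_worlds n 5 m k (2 * n + 1) B C s} \<ge> 1 - 1 / real n ^ d"
proof -
  define B where "B = (\<lambda>(\<Delta> :: nat) (bs :: bool list) (v :: nat). (4 :: nat, 0 :: nat))"
  define C where "C = (\<lambda>(\<Delta> :: nat) (j :: nat) (bs :: bool list) (c :: nat). 0 :: nat)"
  define s where "s = (\<lambda>(\<Delta> :: nat) (j :: nat). if j = 4 then 2 * n + 1 else 0)"
  show ?thesis
  proof (rule exI[of _ B], rule exI[of _ C], rule exI[of _ s], intro allI impI, elim conjE)
    fix E and \<Psi> :: "nat \<Rightarrow> nat set"
    assume inst: "list_coloring_instance {..<n} E \<Psi>" and colors: "\<forall>v<n. \<Psi> v \<subseteq> {..<2 ^ K}"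
    let ?W = "{\<omega>. (E, \<Psi>, \<omega>) \<in> good_worlds n 5 m k (2 * n + 1) B C s}"
    have graph: "simple_graph {..<n} E" using inst by (simp add: list_coloring_instance_def)
    note N = max_degree_bounds[OF graph]
    have list: "card (\<Psi> v) = max_degree {..<n} E + 1" if "v < n" for v
      using inst that by (auto simp: list_coloring_instance_def)
    have finite_list: "finite (\<Psi> v)" if "v < n" for v
      using list[OF that] by (intro card_ge_0_finite) simp
    have binned: "binned_coloring n 5 E \<Psi> (\<lambda>_. (4, 0)) (\<lambda>_ _. 0)"
      by unfold_locales (use graph N finite_list list in \<open>auto intro!: last_phase_slack simp: less_Suc_eq_le\<close>)
    have deg: "card (bin_nbrs (\<lambda>_. (4, 0)) (neighbors E) v) \<le> n" if "v < n" for v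
      using N[OF that] by (simp add: bin_nbrs_def)
    have classes: "card (bin_class n (\<lambda>_. (4, 0)) p) \<le> n" for p
      using card_mono[of "{..<n}" "bin_class n (\<lambda>_. (4, 0)) p"] by (auto simp: bin_class_def)
    have "\<forall>v<n. \<Psi> v \<subseteq> {..<2 ^ k}"
      using colors k by (meson lessThan_subset_iff order.trans one_le_numeral power_increasing)
    moreover have "card (bin_class n (\<lambda>_. (4, 0)) p) * (2 * n + 1) \<le> (2 * n + 1) * n" for p
      using mult_right_mono[OF classes, of "2 * n + 1"] by (simp only: mult.commute)
    moreover have "snd (4 :: nat, 0 :: nat) < n" using n by simp
    moreover have "2 * card (bin_nbrs (\<lambda>_. (4, 0)) (neighbors E) v) + 1 \<le> 2 * n + 1" if "v < n" for v
      using deg[OF that] by simp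
    ultimately have "\<omega> \<in> ?W" if "(\<forall>v<n. length (\<omega> v) = m) \<and> (\<forall>v\<ge>n. \<omega> v = [])" for \<omega>
      using that inst binned unfolding good_worlds_def mem_Collect_eq prod.case Let_def B_def C_def s_def
      by simp
    then have "AE \<omega> in measure_pmf (coin_flips n m). \<omega> \<in> ?W"
      by (rule eventually_mono[OF AE_coin_flips])
    then have "measure_pmf.prob (coin_flips n m) ?W = 1"
      by (subst measure_pmf.prob_eq_1) auto
    then show "1 - 1 / real n ^ d \<le> measure_pmf.prob (coin_flips n m) ?W" by simp
  qed
qed

lemma le_power_log: "n \<le> 2 ^ nat \<lceil>log 2 (real n)\<rceil>"
proof (cases "n = 0")
  case False
  then have "real n = 2 powr log 2 (real n)" by simp
  also have "\<dots> \<le> 2 powr real (nat \<lceil>log 2 (real n)\<rceil>)"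
    by (intro powr_mono) (auto simp: real_nat_ceiling_ge)
  also have "\<dots> = real (2 ^ nat \<lceil>log 2 (real n)\<rceil>)" by (simp add: powr_realpow)
  finally show ?thesis by (simp only: of_nat_le_iff)
qed simp

lemma log_bits_bigo: "(\<lambda>n. real (nat \<lceil>log 2 (real n)\<rceil>)) \<in> O(\<lambda>n. ln (real n))"
proof -
  have "eventually (\<lambda>n. norm (real (nat \<lceil>log 2 (real n)\<rceil>)) \<le> 1 * norm (log 2 (real n) + 1)) sequentially"
    using eventually_ge_at_top[of 1]
  proof eventually_elim
    case (elim n)
    then have "log 2 (real n) \<ge> 0" by simp
    then show ?case by simp
  qed
  then have "(\<lambda>n. real (nat \<lceil>log 2 (real n)\<rceil>)) \<in> O(\<lambda>n. log 2 (real n) + 1)"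
    by (rule bigoI)
  also have "(\<lambda>n. log 2 (real n) + 1) \<in> O(\<lambda>n. ln (real n))"
    by real_asymp
  finally show ?thesis .
qed

lemma proper_list_coloring_cong:
  assumes "E \<subseteq> V \<times> V" "\<And>v. v \<in> V \<Longrightarrow> f v = g v"
  shows "proper_list_coloring V E \<Psi> f \<longleftrightarrow> proper_list_coloring V E \<Psi> g"
proof -
  have "(case e of (u, v) \<Rightarrow> f u \<noteq> f v) \<longleftrightarrow> (case e of (u, v) \<Rightarrow> g u \<noteq> g v)" if "e \<in> E" for e
    using that assms by (cases e) auto
  then show ?thesis
    unfolding proper_list_coloring_def using assms(2) by (simp cong: ball_cong)
qed

theorem theorem3p2:
  fixes \<epsilon> :: real and D K :: "nat \<Rightarrow> nat" and d :: nat
  assumes "\<epsilon> > 0"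
    and "(\<lambda>n. real (D n)) \<in> \<Omega>(\<lambda>n. ln (real n) powr (4 + \<epsilon>))"
    and "(\<lambda>n. real (K n)) \<in> O(\<lambda>n. ln (real n))"
  shows "\<exists>A :: (nat set \<times> nat set, nat) cc_algorithm.
           congested_clique_bandwidth A \<and>
           (\<lambda>n. real (rounds A n)) \<in> O(\<lambda>_. 1) \<and>
           (\<forall>n\<ge>1. \<forall>E \<Psi>.
              list_coloring_instance {..<n} E \<Psi> \<and>
              (\<forall>v<n. \<Psi> v \<subseteq> {..<2 ^ K n}) \<and>
              max_degree {..<n} E \<ge> D n \<longrightarrow>
              measure_pmf.prob (run A n (local_input E \<Psi>))
                {f. proper_list_coloring {..<n} E \<Psi> f} \<ge> 1 - 1 / real n ^ d)"
proof -
  define L where "L n = nat \<lceil>log 2 (real n)\<rceil>" for n :: nat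
  \<comment> \<open>Then \<open>2 ^ m n\<close> is at least \<open>n ^ (d + 3) * 2 ^ K n\<close>:
    beyond \<open>n ^ (d + 1)\<close>, one factor \<open>n\<close> helps to bound
    \<open>max n (2 ^ K n)\<close> and one absorbs the constant 6.\<close>
  define m where "m n = K n + (d + 3) * L n" for n
  \<comment> \<open>A common word length for vertices and colors.\<close>
  define k where "k n = K n + L n" for n
  \<comment> \<open>Since \<open>2 \<le> exp 1\<close>, this yields
    \<open>2 ^ m n * (36 * n * exp (- y n)) \<le> 1\<close>, while \<open>y\<close> stays
    logarithmic.\<close>
  define y where "y n = real (m n) + ln (36 * real n)" for n
  define big where "big n \<longleftrightarrow> n \<ge> 6 \<and> 1 \<le> y n \<and> 14 ^ 8 * y n ^ 4 \<le> real (D n) \<and> (y n)\<^sup>2 \<le> real n" for n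
  define c where "c n = (if big n then 21 else 2 * n + 1)" for n
  define r where "r n = 1 + 5 * (2 * c n + 2)" for n
  define b where "b n = m n + k n + 1" for n
  have m_bigo: "(\<lambda>n. real (m n)) \<in> O(\<lambda>n. ln (real n))"
    unfolding m_def of_nat_add of_nat_mult L_def
    by (intro sum_in_bigo assms(3) landau_o.big.cmult_in_iff[THEN iffD2] log_bits_bigo) auto
  have b_bigo: "(\<lambda>n. real (b n)) \<in> O(\<lambda>n. ln (real n))"
  proof -
    have "(\<lambda>n. real (k n)) \<in> O(\<lambda>n. ln (real n))"
      unfolding k_def of_nat_add L_def by (intro sum_in_bigo assms(3) log_bits_bigo)
    moreover have "(\<lambda>n :: nat. 1) \<in> O(\<lambda>n. ln (real n))" by real_asymp
    ultimately show ?thesis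
      unfolding b_def of_nat_add of_nat_1 by (intro sum_in_bigo m_bigo)
  qed
  have y_bigo: "y \<in> O(\<lambda>n. ln (real n))"
  proof -
    have "(\<lambda>n. ln (36 * real n)) \<in> O(\<lambda>n. ln (real n))" by real_asymp
    then show ?thesis unfolding y_def[abs_def] by (intro sum_in_bigo m_bigo)
  qed
  have "eventually big sequentially"
  proof -
    have "(\<lambda>n. y n ^ 4) \<in> O(\<lambda>n. ln (real n) ^ 4)" by (intro landau_o.big_power y_bigo)
    \<comment> \<open>Here \<epsilon> is spent: it beats the unknown constant in
      \<open>y = O(ln n)\<close> together with \<open>14 ^ 8\<close>.\<close>
    also have "(\<lambda>n. ln (real n) ^ 4) \<in> o(\<lambda>n. ln (real n) powr (4 + \<epsilon>))"
      using assms(1) by real_asymp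
    also have "(\<lambda>n. ln (real n) powr (4 + \<epsilon>)) \<in> O(\<lambda>n. real (D n))"
      using assms(2) by (simp add: bigomega_iff_bigo)
    finally have "eventually (\<lambda>n. norm (y n ^ 4) \<le> 1 / 14 ^ 8 * norm (real (D n))) sequentially"
      by (rule landau_o.smallD) simp
    moreover have "eventually (\<lambda>n. norm ((y n)\<^sup>2) \<le> 1 * norm (real n)) sequentially"
    proof -
      have "(\<lambda>n. (y n)\<^sup>2) \<in> O(\<lambda>n. (ln (real n))\<^sup>2)" by (intro landau_o.big_power y_bigo)
      also have "(\<lambda>n. (ln (real n))\<^sup>2) \<in> o(\<lambda>n. real n)" by real_asymp
      finally show ?thesis by (rule landau_o.smallD) simp
    qed
    ultimately show ?thesis
      using eventually_ge_at_top[of 6]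
    proof eventually_elim
      case (elim n)
      have "exp 1 \<le> 36 * real n" using exp_le elim(3) by simp
      then have "1 \<le> ln (36 * real n)" using elim(3) by (subst ln_ge_iff) auto
      then show ?case using elim by (simp add: big_def y_def)
    qed
  qed
  \<comment> \<open>221 = 1 + 5 * (2 * 21 + 2): one round for the seeds, then five phases.\<close>
  then have "eventually (\<lambda>n. norm (real (r n)) \<le> 221 * norm (1 :: real)) sequentially"
    by eventually_elim (simp add: r_def c_def)
  then have r_bigo: "(\<lambda>n. real (r n)) \<in> O(\<lambda>_. 1)" by (rule bigoI)

  have "\<exists>B C s. \<forall>E \<Psi>. list_coloring_instance {..<n} E \<Psi> \<and> (\<forall>v<n. \<Psi> v \<subseteq> {..<2 ^ K n}) \<and>
     max_degree {..<n} E \<ge> D n \<longrightarrow>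
     measure_pmf.prob (coin_flips n (m n)) {\<omega>. (E, \<Psi>, \<omega>) \<in> good_worlds n 5 (m n) (k n) (c n) B C s}
       \<ge> 1 - 1 / real n ^ d" if n: "n \<ge> 1" for n
  proof (cases "big n")
    case True
    have "(2 :: real) ^ m n \<le> exp (real (m n))"
      using power_mono[OF exp_ge_add_one_self[of 1], of "m n"] by (simp add: exp_of_nat_mult[symmetric])
    then have "2 ^ m n * (36 * real n * exp (- y n)) \<le> exp (real (m n)) * (36 * real n * exp (- y n))"
      by (intro mult_right_mono) auto
    also have "\<dots> = 1"
      using n by (simp add: y_def exp_minus exp_add exp_diff)
    finally have 1: "2 ^ m n * (36 * real n * exp (- y n)) \<le> 1" .
    have "6 * n ^ (d + 1) * max n (2 ^ K n) \<le> 6 * n ^ (d + 1) * (n * 2 ^ K n)"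
      using n by (intro mult_left_mono) auto
    also have "\<dots> = 6 * (n ^ (d + 2) * 2 ^ K n)" by simp
    \<comment> \<open>The constant 6 is absorbed by \<open>n \<ge> 6\<close>.\<close>
    also have "\<dots> \<le> n * (n ^ (d + 2) * 2 ^ K n)"
      using True by (intro mult_right_mono) (auto simp: big_def)
    also have "\<dots> = n ^ (d + 3) * 2 ^ K n" by (simp add: power_add eval_nat_numeral)
    also have "\<dots> \<le> (2 ^ L n) ^ (d + 3) * 2 ^ K n"
      unfolding L_def by (intro mult_right_mono power_mono le_power_log) auto
    also have "\<dots> = 2 ^ m n" by (simp add: m_def power_add[symmetric] power_mult[symmetric] mult.commute add.commute)
    finally have 2: "6 * n ^ (d + 1) * max n (2 ^ K n) \<le> 2 ^ m n" .
    show ?thesis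
      using seeds_large[OF _ _ _ _ 1 2, of "D n" "k n"] True by (simp add: big_def c_def k_def)
  next
    case False
    then show ?thesis using seeds_small[OF n, of "K n" "k n" "D n" d "m n"] by (simp add: c_def k_def)
  qed
  \<comment> \<open>The guard moves under the quantifiers so that families can be chosen for all
    \<open>n\<close> at once.\<close>
  then have "\<exists>B C s. n \<ge> 1 \<longrightarrow> (\<forall>E \<Psi>. list_coloring_instance {..<n} E \<Psi> \<and> (\<forall>v<n. \<Psi> v \<subseteq> {..<2 ^ K n}) \<and>
     max_degree {..<n} E \<ge> D n \<longrightarrow>
     measure_pmf.prob (coin_flips n (m n)) {\<omega>. (E, \<Psi>, \<omega>) \<in> good_worlds n 5 (m n) (k n) (c n) B C s}
       \<ge> 1 - 1 / real n ^ d)" for n by blast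
  then obtain B C s where seeds: "\<And>n E \<Psi>. n \<ge> 1 \<Longrightarrow> list_coloring_instance {..<n} E \<Psi> \<Longrightarrow>
     (\<forall>v<n. \<Psi> v \<subseteq> {..<2 ^ K n}) \<Longrightarrow> max_degree {..<n} E \<ge> D n \<Longrightarrow>
     measure_pmf.prob (coin_flips n (m n)) {\<omega>. (E, \<Psi>, \<omega>) \<in> good_worlds n 5 (m n) (k n) (c n) (B n) (C n) (s n)}
       \<ge> 1 - 1 / real n ^ d" by metis
  have "learns n (b n) (good_worlds n 5 (m n) (k n) (c n) (B n) (C n) (s n))
     (\<lambda>(E, \<Psi>, \<omega>) v. (local_input E \<Psi> v, \<omega> v)) (r n) (seeded_col n 5 (B n) (C n))" for n
    unfolding r_def
  proof (rule learns_coloring)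
    have "n \<le> 2 ^ L n" unfolding L_def by (rule le_power_log)
    also have "\<dots> \<le> 2 ^ k n" by (simp add: k_def)
    finally show "n \<le> 2 ^ k n" .
  qed (auto simp: b_def)
  then obtain A :: "(nat set \<times> nat set, nat) cc_algorithm" where
    A: "num_coins A = m" "rounds A = r" "\<And>n s w. length (send A n s w) \<le> b n" and
    result: "\<And>n w x \<omega> v. w \<in> good_worlds n 5 (m n) (k n) (c n) (B n) (C n) (s n) \<Longrightarrow>
       (\<lambda>(E, \<Psi>, \<omega>) v. (local_input E \<Psi> v, \<omega> v)) w = (\<lambda>v. (x v, \<omega> v)) \<Longrightarrow> v < n \<Longrightarrow>
       result A n (view_after A n x \<omega> (r n) v) = seeded_col n 5 (B n) (C n) w v"
    by (rule learns_imp_algorithm[where m = m]) blast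
  show ?thesis
  proof (intro exI[of _ A] conjI allI impI)
    show "congested_clique_bandwidth A"
      unfolding congested_clique_bandwidth_def using A(3) b_bigo by blast
    show "(\<lambda>n. real (rounds A n)) \<in> O(\<lambda>_. 1)" using r_bigo by (simp add: A)
    fix n E and \<Psi> :: "nat \<Rightarrow> nat set"
    assume n: "1 \<le> n" and inst: "list_coloring_instance {..<n} E \<Psi> \<and> (\<forall>v<n. \<Psi> v \<subseteq> {..<2 ^ K n}) \<and>
        D n \<le> max_degree {..<n} E"
    let ?W = "good_worlds n 5 (m n) (k n) (c n) (B n) (C n) (s n)"
    have proper: "proper_list_coloring {..<n} E \<Psi>
        (\<lambda>v. result A n (view_after A n (local_input E \<Psi>) \<omega> (rounds A n) v))" if W: "(E, \<Psi>, \<omega>) \<in> ?W" for \<omega>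
    proof -
      have graph: "E \<subseteq> {..<n} \<times> {..<n}"
        using inst by (simp add: list_coloring_instance_def simple_graph_def)
      have "binned_coloring n 5 E \<Psi> (B n (max_degree {..<n} E) (\<omega> 0))
          (\<lambda>j. C n (max_degree {..<n} E) j (\<omega> (Suc j)))"
        using W by (simp add: good_worlds_def Let_def)
      then have "proper_list_coloring {..<n} E \<Psi> (seeded_col n 5 (B n) (C n) (E, \<Psi>, \<omega>))"
        unfolding seeded_col_def prod.case by (rule binned_coloring.proper_list_coloring_col)
      moreover have "result A n (view_after A n (local_input E \<Psi>) \<omega> (rounds A n) v) =
          seeded_col n 5 (B n) (C n) (E, \<Psi>, \<omega>) v" if "v < n" for v
        using result[OF W _ that] by (simp add: A)
      ultimately show ?thesis
        by (subst proper_list_coloring_cong[OF graph, where g = "seeded_col n 5 (B n) (C n) (E, \<Psi>, \<omega>)"])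
          simp_all
    qed
    have "1 - 1 / real n ^ d \<le> measure_pmf.prob (coin_flips n (m n)) {\<omega>. (E, \<Psi>, \<omega>) \<in> ?W}"
      using seeds[OF n] inst by blast
    also have "\<dots> \<le> measure_pmf.prob (coin_flips n (m n)) {\<omega>. proper_list_coloring {..<n} E \<Psi>
        (\<lambda>v. result A n (view_after A n (local_input E \<Psi>) \<omega> (rounds A n) v))}"
      using proper by (intro measure_pmf.finite_measure_mono) auto
    also have "\<dots> = measure_pmf.prob (run A n (local_input E \<Psi>)) {f. proper_list_coloring {..<n} E \<Psi> f}"
      by (simp add: run_def A(1) vimage_def)
    finally show "1 - 1 / real n ^ d \<le> measure_pmf.prob (run A n (local_input E \<Psi>)) {f. proper_list_coloring {..<n} E \<Psi> f}" .
  qed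
qed

end
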